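(* Let $(R,\mathfrak{m},K)$ be a local Artinian commutative ring. Then $R$ is Frobenius if and only if $$W_{C^\perp}(x,y,z)=\frac{1}{z^{\lambda(C)}}\,W_C\bigl(x+z^{\lambda(R)}y-y,\;x-y,\;z\bigr)$$ (as an identity in $\mathbb{Z}[x,y,z,z^{-1}]$) for every integer $n\ge1$ and every $R$-code $C\subseteq R^n$.
   Context: All rings are commutative with unity. $(R,\mathfrak{m},K)$ is a local Artinian ring with maximal ideal $\mathfrak{m}$ and residue field $K=R/\mathfrak{m}$ (not necessarily finite). $R$ is Frobenius if $\operatorname{soc}(R)=\{r\in R:\mathfrak{m}r=0\}\cong K$. An $R$-code of length $n$ is an $R$-submodule $C\subseteq R^n$. $\lambda(M)$ denotes the length of an $R$-module $M$. The orthogonal code is $C^\perp=\{v\in R^n : v\cdot w=0 \text{ for all } w\in C\}$, where $v\cdot w=v_1w_1+\cdots+v_nw_n$. Let $[n]=\{1,\dots,n\}$ and $\operatorname{supp}(v)=\{i : v_i\ne 0\}$. For $\mathcal{A}\subseteq[n]$, $C(\mathcal{A})=\{v\in C : \operatorname{supp}(v)\subseteq\mathcal{A}\}$. For $0\le i\le n$ the $i$-th weight polynomial is $$g^C_i(z)=\sum_{a=0}^{i}\ \sum_{\mathcal{A}\subseteq[n],\,|\mathcal{A}|=a}(-1)^{i-a}\binom{n-a}{i-a}z^{\lambda(C(\mathcal{A}))},$$ and the weight enumerator of $C$ is $W_C(x,y,z)=\sum_{i=0}^n g^C_i(z)\,x^{n-i}y^i$. *)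

theory Defs
  imports
    "HOL-Computational_Algebra.Polynomial"
    "HOL-Library.Extended_Nat"
    "HOL-Library.Poly_Mapping"
    "HOL-Library.Product_Plus"
    "HOL-Algebra.QuotRing"
    "HOL-Algebra.Module"
begin

section \<open>Modules and length\<close>

definition regular_module :: "('a, 'c) ring_scheme \<Rightarrow> ('a, 'a) module"
  where "regular_module R =
    \<lparr>carrier = carrier R, mult = (\<otimes>\<^bsub>R\<^esub>), one = \<one>\<^bsub>R\<^esub>, zero = \<zero>\<^bsub>R\<^esub>, add = (\<oplus>\<^bsub>R\<^esub>),
     smult = (\<otimes>\<^bsub>R\<^esub>)\<rparr>"

definition quotient_module :: "('a, 'c) ring_scheme \<Rightarrow> 'a set \<Rightarrow> ('a, 'a set) module"
  where "quotient_module R I =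
    \<lparr>carrier = carrier (R Quot I), mult = (\<otimes>\<^bsub>R Quot I\<^esub>), one = \<one>\<^bsub>R Quot I\<^esub>,
     zero = \<zero>\<^bsub>R Quot I\<^esub>, add = (\<oplus>\<^bsub>R Quot I\<^esub>),
     smult = (\<lambda>r X. (I +>\<^bsub>R\<^esub> r) \<otimes>\<^bsub>R Quot I\<^esub> X)\<rparr>"

text \<open>The module \<open>R\<^sup>n\<close>; vectors are extensional functions on \<open>{1..n}\<close>. The record type of modules
  also demands a multiplication and a unit, which play no role; they are taken componentwise.\<close>

definition free_module :: "('a, 'c) ring_scheme \<Rightarrow> nat \<Rightarrow> ('a, nat \<Rightarrow> 'a) module"
  where "free_module R n =
    \<lparr>carrier = {1..n} \<rightarrow>\<^sub>E carrier R,
     mult = (\<lambda>v w. \<lambda>i\<in>{1..n}. v i \<otimes>\<^bsub>R\<^esub> w i),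
     one = (\<lambda>i\<in>{1..n}. \<one>\<^bsub>R\<^esub>),
     zero = (\<lambda>i\<in>{1..n}. \<zero>\<^bsub>R\<^esub>),
     add = (\<lambda>v w. \<lambda>i\<in>{1..n}. v i \<oplus>\<^bsub>R\<^esub> w i),
     smult = (\<lambda>r v. \<lambda>i\<in>{1..n}. r \<otimes>\<^bsub>R\<^esub> v i)\<rparr>"

lemma (in cring) regular_module_is_module: "module R (regular_module R)"
  by (rule moduleI) (unfold_locales, auto simp: regular_module_def l_distr r_distr m_assoc l_neg Units_def a_ac intro: add.inv_closed)

lemma (in cring) free_module_is_module: "module R (free_module R n)"
proof (rule moduleI)
  show "abelian_group (free_module R n)"
  proof (rule abelian_groupI)
    fix x assume "x \<in> carrier (free_module R n)"
    then show "\<exists>y\<in>carrier (free_module R n). y \<oplus>\<^bsub>free_module R n\<^esub> x = \<zero>\<^bsub>free_module R n\<^esub>"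
      by (intro bexI[of _ "\<lambda>i\<in>{1..n}. \<ominus> x i"]) (auto simp: free_module_def l_neg PiE_iff fun_eq_iff)
  qed (auto simp: free_module_def a_ac PiE_iff fun_eq_iff extensional_def)
qed (auto simp: free_module_def l_distr r_distr m_assoc is_cring PiE_iff fun_eq_iff extensional_def)

lemma (in cring) quotient_module_is_module:
  assumes "ideal I R"
  shows "module R (quotient_module R I)"
proof -
  interpret ideal I R by fact
  interpret Q: cring "R Quot I" by (rule quotient_is_cring) (rule is_cring)
  interpret h: ring_hom_cring R "R Quot I" "(+>) I" by (rule rcos_ring_hom_cring) (rule is_cring)
  show ?thesis
  proof (rule moduleI)
    show "abelian_group (quotient_module R I)"
      by (rule abelian_groupI)
        (auto simp: quotient_module_def Q.a_ac intro: Q.l_neg Q.a_inv_closed)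
  qed (auto simp: quotient_module_def is_cring Q.l_distr Q.r_distr Q.m_assoc)
qed

definition module_isomorphic ::
  "('a, 'd) ring_scheme \<Rightarrow> ('a, 'b, 'e) module_scheme \<Rightarrow> ('a, 'c, 'f) module_scheme \<Rightarrow> bool"
  where "module_isomorphic R M N \<longleftrightarrow>
    (\<exists>f \<in> iso (add_monoid M) (add_monoid N).
      \<forall>r\<in>carrier R. \<forall>x\<in>carrier M. f (r \<odot>\<^bsub>M\<^esub> x) = r \<odot>\<^bsub>N\<^esub> f x)"

text \<open>The length of a module is the supremum of the lengths \<open>k\<close> of strict chains
  \<open>N 0 \<subset> \<dots> \<subset> N k\<close> of submodules.\<close>

definition module_length :: "('a, 'c) ring_scheme \<Rightarrow> ('a, 'b, 'd) module_scheme \<Rightarrow> enat"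
  where "module_length R M =
    Sup {enat k | k. \<exists>N :: nat \<Rightarrow> 'b set.
      (\<forall>i\<le>k. submodule (N i) R M) \<and> (\<forall>i<k. N i \<subset> N (Suc i))}"


section \<open>Local Artinian rings, socle, Frobenius rings\<close>

locale local_artinian_ring = maximalideal \<mm> R + cring R for R (structure) and \<mm> +
  assumes unique_maximal: "maximalideal J R \<Longrightarrow> J = \<mm>"
    and descending_chain:
      "(\<And>k :: nat. ideal (I k) R) \<Longrightarrow> (\<And>k. I (Suc k) \<subseteq> I k) \<Longrightarrow> \<exists>N. \<forall>k\<ge>N. I k = I N"

definition socle :: "('a, 'c) ring_scheme \<Rightarrow> 'a set \<Rightarrow> 'a set"
  where "socle R \<mm> = {r \<in> carrier R. \<forall>x\<in>\<mm>. x \<otimes>\<^bsub>R\<^esub> r = \<zero>\<^bsub>R\<^esub>}"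

lemma (in local_artinian_ring) socle_is_submodule:
  "submodule (socle R \<mm>) R (regular_module R)"
proof -
  interpret M: module R "regular_module R" by (rule regular_module_is_module)
  have i: "\<ominus>\<^bsub>regular_module R\<^esub> a = \<ominus> a" for a by (simp add: a_inv_def m_inv_def regular_module_def)
  show ?thesis
  by (rule M.submoduleI) (auto simp: i, auto simp: regular_module_def socle_def r_minus r_distr, metis a_Hcarr m_assoc m_comm r_null)
qed

definition frobenius_ring :: "('a, 'c) ring_scheme \<Rightarrow> 'a set \<Rightarrow> bool"
  where "frobenius_ring R \<mm> \<longleftrightarrow>
    module_isomorphic R ((regular_module R)\<lparr>carrier := socle R \<mm>\<rparr>) (quotient_module R \<mm>)"


section \<open>Codes\<close>

definition is_code :: "('a, 'c) ring_scheme \<Rightarrow> nat \<Rightarrow> (nat \<Rightarrow> 'a) set \<Rightarrow> bool"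
  where "is_code R n C \<longleftrightarrow> submodule C R (free_module R n)"

text \<open>Over an Artinian ring \<open>R\<close> every submodule of \<open>R\<^sup>n\<close> has finite length, so that \<open>the_enat\<close> loses
  nothing in the two lengths below.\<close>

definition ring_length :: "('a, 'c) ring_scheme \<Rightarrow> nat"
  where "ring_length R = the_enat (module_length R (regular_module R))"

definition code_length :: "('a, 'c) ring_scheme \<Rightarrow> nat \<Rightarrow> (nat \<Rightarrow> 'a) set \<Rightarrow> nat"
  where "code_length R n C = the_enat (module_length R ((free_module R n)\<lparr>carrier := C\<rparr>))"

definition dot_prod :: "('a, 'c) ring_scheme \<Rightarrow> nat \<Rightarrow> (nat \<Rightarrow> 'a) \<Rightarrow> (nat \<Rightarrow> 'a) \<Rightarrow> 'a"
  where "dot_prod R n v w = (\<Oplus>\<^bsub>R\<^esub>i\<in>{1..n}. v i \<otimes>\<^bsub>R\<^esub> w i)"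

definition orthogonal_code :: "('a, 'c) ring_scheme \<Rightarrow> nat \<Rightarrow> (nat \<Rightarrow> 'a) set \<Rightarrow> (nat \<Rightarrow> 'a) set"
  where "orthogonal_code R n C =
    {v \<in> carrier (free_module R n). \<forall>w\<in>C. dot_prod R n v w = \<zero>\<^bsub>R\<^esub>}"

definition supp :: "('a, 'c) ring_scheme \<Rightarrow> nat \<Rightarrow> (nat \<Rightarrow> 'a) \<Rightarrow> nat set"
  where "supp R n v = {i \<in> {1..n}. v i \<noteq> \<zero>\<^bsub>R\<^esub>}"

definition supported_subcode ::
  "('a, 'c) ring_scheme \<Rightarrow> nat \<Rightarrow> (nat \<Rightarrow> 'a) set \<Rightarrow> nat set \<Rightarrow> (nat \<Rightarrow> 'a) set"
  where "supported_subcode R n C A = {v \<in> C. supp R n v \<subseteq> A}"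

definition weight_poly ::
  "('a, 'c) ring_scheme \<Rightarrow> nat \<Rightarrow> (nat \<Rightarrow> 'a) set \<Rightarrow> nat \<Rightarrow> int poly"
  where "weight_poly R n C i =
    (\<Sum>a\<in>{0..i}. \<Sum>A | A \<subseteq> {1..n} \<and> card A = a.
      monom ((-1) ^ (i - a) * int ((n - a) choose (i - a)))
        (code_length R n (supported_subcode R n C A)))"

text \<open>The weight enumerator, evaluated at elements \<open>x\<close>, \<open>y\<close>, \<open>z\<close> of an arbitrary commutative ring;
  at indeterminates it is the weight enumerator polynomial itself.\<close>

definition weight_enumerator ::
  "('a, 'c) ring_scheme \<Rightarrow> nat \<Rightarrow> (nat \<Rightarrow> 'a) set \<Rightarrow> 'r \<Rightarrow> 'r \<Rightarrow> 'r \<Rightarrow> 'r :: comm_ring_1"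
  where "weight_enumerator R n C x y z =
    (\<Sum>i\<in>{0..n}. poly (map_poly of_int (weight_poly R n C i)) z * x ^ (n - i) * y ^ i)"


section \<open>The ring \<open>\<int>[x, y, z, z\<inverse>]\<close>\<close>

text \<open>\<open>\<int>[x, y, z, z\<inverse>]\<close> is the monoid ring of \<open>\<nat> \<times> \<nat> \<times> \<int>\<close> over \<open>\<int>\<close>: the exponent \<open>(i, j, k)\<close> stands
  for the monomial \<open>x\<^sup>i y\<^sup>j z\<^sup>k\<close>, where \<open>k\<close> may be negative.\<close>

type_synonym laurent = "(nat \<times> nat \<times> int) \<Rightarrow>\<^sub>0 int"

definition var_x :: laurent where "var_x = Poly_Mapping.single (1, 0, 0) 1"
definition var_y :: laurent where "var_y = Poly_Mapping.single (0, 1, 0) 1"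
definition var_z :: laurent where "var_z = Poly_Mapping.single (0, 0, 1) 1"
definition var_z_inv :: laurent where "var_z_inv = Poly_Mapping.single (0, 0, -1) 1"

lemma var_z_times_var_z_inv: "var_z * var_z_inv = 1"
  by (simp add: var_z_def var_z_inv_def mult_single flip: zero_prod_def)

end

theory Submission
  imports Defs "HOL-Algebra.Ring_Divisibility"
begin

text \<open>Write \<open>c(A)\<close> for \<open>\<lambda>(C(A))\<close>. Summing over supports, the weight enumerator of a code of
length \<open>n\<close> is \<open>\<Sum>A. z^c(A) y^a (x - y)^(n - a)\<close>, where \<open>a\<close> is the size of \<open>A\<close>
(\<open>weight_enumerator_eq_sum_subsets\<close>). The substitution in the theorem turns the summand of \<open>A\<close> into
\<open>z^c(A) (x - y)^a (z^\<lambda>(R) y)^(n - a)\<close>. So the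
identity follows if, for every \<open>A\<close> with complement \<open>A'\<close>,
\<open>\<lambda>(C\<^sup>\<bottom>(A')) + \<lambda>(C) = \<lambda>(R) (n - a) + c(A)\<close>
(\<open>orthogonal_supported_length\<close>). Since \<open>C\<^sup>\<bottom>(A')\<close> is the orthogonal code of \<open>C + R\<^sup>A\<close>, this reduces
to the duality \<open>\<lambda>(C\<^sup>\<bottom>) + \<lambda>(C) = \<lambda>(R) n\<close> (\<open>orthogonal_length\<close>).

Over a Frobenius ring the duality comes from counting steps. If \<open>D = B + R d\<close> with
\<open>\<mm> d \<subseteq> B\<close>, then \<open>v \<mapsto> v \<cdot> d\<close> maps \<open>B\<^sup>\<bottom>\<close> into the socle with kernel \<open>D\<^sup>\<bottom>\<close>
(\<open>orthogonal_step\<close>), so a step up in the code is at most one step down in the orthogonal code. From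
\<open>0\<close> to \<open>R\<^sup>n\<close> both sides have to cover the same distance \<open>\<lambda>(R) n\<close>, hence no step is lost.

Conversely, for \<open>n = 1\<close> the identity says \<open>\<lambda>(C\<^sup>\<bottom>) = \<lambda>(R) - \<lambda>(C)\<close>. For \<open>C = \<mm>\<close> this is
\<open>\<lambda>(soc R) = 1\<close>, and a simple socle is isomorphic to the residue field
(\<open>frobenius_if_sublength_socle\<close>).

The lengths are computed from strict chains of submodules. They are additive along linear maps
(\<open>sublength_rank_nullity\<close>), and they are finite because a local Artinian ring has finite length
(\<open>module_length_regular_finite\<close>).\<close>

section \<open>Lengths of submodules\<close>

text \<open>Positive numbers only: the supremum of the empty set is \<open>0\<close> and is not reached by any element.\<close>

lemma enat_le_Sup_iff:
  "enat (Suc k) \<le> Sup X \<longleftrightarrow> (\<exists>a\<in>X. enat (Suc k) \<le> a)"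
proof
  assume h: "enat (Suc k) \<le> Sup X"
  show "\<exists>a\<in>X. enat (Suc k) \<le> a"
  proof (rule ccontr)
    assume "\<not> ?thesis"
    then have "\<forall>a\<in>X. a \<le> enat k"
      by (metis Suc_ile_eq not_le)
    then have "Sup X \<le> enat k" by (simp add: Sup_least)
    with h show False
      by (meson Suc_ile_eq leD)
  qed
qed (meson Sup_upper order_trans)

text \<open>All lengths are those of submodules \<open>C\<close> of one ambient module \<open>M\<close>; restricting the carrier turns \<open>C\<close>
into a module of its own, whose submodules are exactly the submodules of \<open>M\<close> inside \<open>C\<close>.
Chains can therefore be taken in \<open>M\<close>, which makes lengths of different submodules comparable.\<close>

abbreviation sublength where
  "sublength R M C \<equiv> module_length R (M\<lparr>carrier := C\<rparr>)"

definition submodule_chain ::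
  "('a, 'c) ring_scheme \<Rightarrow> ('a, 'b, 'd) module_scheme \<Rightarrow> 'b set \<Rightarrow> nat \<Rightarrow> (nat \<Rightarrow> 'b set) \<Rightarrow> bool"
  where "submodule_chain R M C k N \<longleftrightarrow>
    (\<forall>i\<le>k. submodule (N i) R M \<and> N i \<subseteq> C) \<and> (\<forall>i<k. N i \<subset> N (Suc i))"

context module
begin

lemma submodule_restrict_iff:
  assumes "submodule C R M"
  shows "submodule N R (M\<lparr>carrier := C\<rparr>) \<longleftrightarrow> submodule N R M \<and> N \<subseteq> C"
proof -
  have eq: "add_monoid (M\<lparr>carrier := C\<rparr>) = (add_monoid M)\<lparr>carrier := C\<rparr>" by simp
  have C: "subgroup C (add_monoid M)" using assms by (rule submodule.axioms)
  have "subgroup N ((add_monoid M)\<lparr>carrier := C\<rparr>) \<longleftrightarrow> subgroup N (add_monoid M) \<and> N \<subseteq> C"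
    using add.incl_subgroup[OF C] add.subgroup_incl[OF _ C]
      subgroup.subset[of N "(add_monoid M)\<lparr>carrier := C\<rparr>"]
    by (metis partial_object.select_convs(1) partial_object.update_convs(1) partial_object.surjective)
  then show ?thesis
    unfolding submodule_def submodule_axioms_def eq by auto
qed

lemma submodule_subset: "submodule C R M \<Longrightarrow> C \<subseteq> carrier M"
  by (rule submoduleE(1))

lemma submodule_zero: "submodule C R M \<Longrightarrow> \<zero>\<^bsub>M\<^esub> \<in> C"
  using submodule.axioms(1) subgroup.one_closed by fastforce

lemma submodule_add: "submodule C R M \<Longrightarrow> x \<in> C \<Longrightarrow> y \<in> C \<Longrightarrow> x \<oplus>\<^bsub>M\<^esub> y \<in> C"
  by (rule submoduleE(5))

lemma submodule_minus: "submodule C R M \<Longrightarrow> x \<in> C \<Longrightarrow> y \<in> C \<Longrightarrow> x \<ominus>\<^bsub>M\<^esub> y \<in> C"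
  by (simp add: a_minus_def submoduleE(3,5))

lemma submodule_smult: "submodule C R M \<Longrightarrow> r \<in> carrier R \<Longrightarrow> x \<in> C \<Longrightarrow> r \<odot>\<^bsub>M\<^esub> x \<in> C"
  by (rule submoduleE(4))

text \<open>Closure under negation comes for free, because \<open>-x = (-1) x\<close>.\<close>

lemma submoduleI':
  assumes "H \<subseteq> carrier M" "\<zero>\<^bsub>M\<^esub> \<in> H"
    and "\<And>a b. a \<in> H \<Longrightarrow> b \<in> H \<Longrightarrow> a \<oplus>\<^bsub>M\<^esub> b \<in> H"
    and "\<And>a x. a \<in> carrier R \<Longrightarrow> x \<in> H \<Longrightarrow> a \<odot>\<^bsub>M\<^esub> x \<in> H"
  shows "submodule H R M"
proof (rule submoduleI)
  fix a assume "a \<in> H"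
  then have "(\<ominus> \<one>) \<odot>\<^bsub>M\<^esub> a = \<ominus>\<^bsub>M\<^esub> a" "(\<ominus> \<one>) \<odot>\<^bsub>M\<^esub> a \<in> H"
    using assms(1) smult_l_minus[of \<one> a] assms(4)[of "\<ominus> \<one>" a] by auto
  then show "\<ominus>\<^bsub>M\<^esub> a \<in> H" by simp
qed (use assms in auto)

lemma submodule_zero_set: "submodule {\<zero>\<^bsub>M\<^esub>} R M"
  by (rule submoduleI') auto

lemma submodule_Int:
  assumes "submodule A R M" "submodule B R M"
  shows "submodule (A \<inter> B) R M"
  by (rule submoduleI')
     (use assms submodule_subset submodule_zero submodule_add submodule_smult in auto)

lemma sublength_ge_iff:
  assumes C: "submodule C R M"
  shows "enat k \<le> sublength R M C \<longleftrightarrow> (\<exists>N. submodule_chain R M C k N)"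
proof (cases k)
  case 0
  have "submodule_chain R M C 0 (\<lambda>_. C)"
    using C by (simp add: submodule_chain_def)
  then show ?thesis using 0 by (auto simp: zero_enat_def[symmetric])
next
  case (Suc k')
  have *: "(\<exists>N. (\<forall>i\<le>l. submodule (N i) R (M\<lparr>carrier := C\<rparr>)) \<and> (\<forall>i<l. N i \<subset> N (Suc i)))
      \<longleftrightarrow> (\<exists>N. submodule_chain R M C l N)" for l
    by (simp add: submodule_chain_def submodule_restrict_iff[OF C])
  have mono: "submodule_chain R M C l N \<Longrightarrow> k \<le> l \<Longrightarrow> submodule_chain R M C k N" for l N
    by (auto simp: submodule_chain_def)
  show ?thesis
    unfolding module_length_def Suc enat_le_Sup_iff
    using mono by (simp add: * Suc[symmetric]) (metis enat_ord_simps(1) order_refl)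
qed

lemma sublength_mono:
  assumes "submodule A R M" "submodule B R M" "A \<subseteq> B"
  shows "sublength R M A \<le> sublength R M B"
proof (rule ccontr)
  assume "\<not> ?thesis"
  then have less: "sublength R M B < sublength R M A" by (simp only: not_le)
  then obtain k where k: "sublength R M B = enat k" by (cases "sublength R M B") auto
  have lt: "enat k < sublength R M A" using less unfolding k .
  then have "enat (Suc k) \<le> sublength R M A" by (simp add: Suc_ile_eq)
  then obtain N where "submodule_chain R M A (Suc k) N" using sublength_ge_iff[OF assms(1)] by auto
  then have "submodule_chain R M B (Suc k) N" using assms(3) unfolding submodule_chain_def by blast
  then have "enat (Suc k) \<le> sublength R M B" using sublength_ge_iff[OF assms(2)] by blast
  then show False using k by simp
qed

text \<open>A chain in \<open>A\<close> is prolonged by \<open>B\<close>. The form with \<open>eSuc\<close> also covers infinite lengths; it is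
a strict inequality only when \<open>A\<close> has finite length.\<close>

lemma sublength_strict_mono:
  assumes A: "submodule A R M" and B: "submodule B R M" and AB: "A \<subset> B"
  shows "eSuc (sublength R M A) \<le> sublength R M B"
proof -
  have step: "enat (Suc k) \<le> sublength R M B" if k: "enat k \<le> sublength R M A" for k
  proof -
    from k obtain N where "submodule_chain R M A k N" using sublength_ge_iff[OF A] by auto
    then have "submodule_chain R M B (Suc k) (N(Suc k := B))"
      using B AB by (auto simp: submodule_chain_def le_Suc_eq less_Suc_eq)
    then show ?thesis using sublength_ge_iff[OF B] by blast
  qed
  show ?thesis
  proof (cases "sublength R M A")
    case (enat k)
    then show ?thesis using step[of k] by (simp add: eSuc_enat)
  next
    case infinity
    have "sublength R M B = \<infinity>"
    proof (rule ccontr)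
      assume "sublength R M B \<noteq> \<infinity>"
      then obtain l where "sublength R M B = enat l" by auto
      with step[of l] infinity show False by simp
    qed
    then show ?thesis by simp
  qed
qed

text \<open>The values of \<open>g\<close> increase by at least one with each step of a chain. All upper bounds on lengths
  come from such rank functions.\<close>

lemma sublength_le_rank:
  fixes g :: "'c set \<Rightarrow> nat"
  assumes C: "submodule C R M"
    and mono: "\<And>A B. submodule A R M \<Longrightarrow> submodule B R M \<Longrightarrow> A \<subset> B \<Longrightarrow> B \<subseteq> C \<Longrightarrow> g A < g B"
    and bound: "\<And>A. submodule A R M \<Longrightarrow> A \<subseteq> C \<Longrightarrow> g A \<le> b"
  shows "sublength R M C \<le> enat b"
proof (rule ccontr)
  assume "\<not> ?thesis"
  then have "enat (Suc b) \<le> sublength R M C" by (simp add: Suc_ile_eq)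
  then obtain N where N: "submodule_chain R M C (Suc b) N" using sublength_ge_iff[OF C] by auto
  have "i \<le> Suc b \<Longrightarrow> i \<le> g (N i)" for i
  proof (induction i)
    case (Suc i)
    have "g (N i) < g (N (Suc i))"
      by (rule mono) (use N Suc.prems in \<open>auto simp: submodule_chain_def\<close>)
    then show ?case using Suc by auto
  qed simp
  from this[of "Suc b"] have "Suc b \<le> g (N (Suc b))" by simp
  moreover have "g (N (Suc b)) \<le> b" using N bound by (auto simp: submodule_chain_def)
  ultimately show False by simp
qed

lemma sublength_zero_set: "sublength R M {\<zero>\<^bsub>M\<^esub>} = 0"
proof -
  have "sublength R M {\<zero>\<^bsub>M\<^esub>} \<le> enat 0"
  proof (rule sublength_le_rank[OF submodule_zero_set, of "\<lambda>_. 0"])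
    fix A B assume AB: "submodule A R M" "submodule B R M" "A \<subset> B" "B \<subseteq> {\<zero>\<^bsub>M\<^esub>}"
    then have "A = B" using submodule_zero[of A] submodule_zero[of B] by blast
    with AB show "(0::nat) < 0" by simp
  qed simp
  then show ?thesis by (simp add: zero_enat_def[symmetric])
qed

end

section \<open>Additivity of length along linear maps\<close>

text \<open>Quotient modules are avoided throughout: a quotient enters only as the image of a linear map,
and additivity of length takes the form of a rank-nullity formula.\<close>

locale linear_map = dom: module R M + cod: module R N
  for R (structure) and M (structure) and N (structure) and f +
  assumes closed: "x \<in> carrier M \<Longrightarrow> f x \<in> carrier N"
    and add: "x \<in> carrier M \<Longrightarrow> y \<in> carrier M \<Longrightarrow> f (x \<oplus>\<^bsub>M\<^esub> y) = f x \<oplus>\<^bsub>N\<^esub> f y"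
    and smult: "r \<in> carrier R \<Longrightarrow> x \<in> carrier M \<Longrightarrow> f (r \<odot>\<^bsub>M\<^esub> x) = r \<odot>\<^bsub>N\<^esub> f x"
begin

lemma zero: "f \<zero>\<^bsub>M\<^esub> = \<zero>\<^bsub>N\<^esub>"
  using smult[of "\<zero>\<^bsub>R\<^esub>" "\<zero>\<^bsub>M\<^esub>"] closed[of "\<zero>\<^bsub>M\<^esub>"] by simp

lemma minus:
  assumes "x \<in> carrier M" "y \<in> carrier M"
  shows "f (x \<ominus>\<^bsub>M\<^esub> y) = f x \<ominus>\<^bsub>N\<^esub> f y"
proof -
  have *: "(\<ominus> \<one>) \<odot>\<^bsub>M\<^esub> y = \<ominus>\<^bsub>M\<^esub> y" "(\<ominus> \<one>) \<odot>\<^bsub>N\<^esub> f y = \<ominus>\<^bsub>N\<^esub> f y"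
    using dom.smult_l_minus[of \<one> y] cod.smult_l_minus[of \<one> "f y"] assms closed by simp_all
  have "f (\<ominus>\<^bsub>M\<^esub> y) = \<ominus>\<^bsub>N\<^esub> f y"
    using smult[of "\<ominus> \<one>" y] assms by (simp add: *)
  then show ?thesis
    using add[of x "\<ominus>\<^bsub>M\<^esub> y"] assms by (simp add: a_minus_def)
qed

lemma image_submodule:
  assumes "submodule A R M"
  shows "submodule (f ` A) R N"
proof (rule cod.submoduleI')
  note A = dom.submodule_subset[OF assms]
  show "f ` A \<subseteq> carrier N" using A closed by auto
  show "\<zero>\<^bsub>N\<^esub> \<in> f ` A" using zero dom.submodule_zero[OF assms] by (metis image_eqI)
  show "a \<oplus>\<^bsub>N\<^esub> b \<in> f ` A" if "a \<in> f ` A" "b \<in> f ` A" for a b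
  proof -
    from that obtain u v where "u \<in> A" "v \<in> A" "a = f u" "b = f v" by auto
    then show ?thesis using A add[of u v] dom.submodule_add[OF assms, of u v] by (metis image_eqI subsetD)
  qed
  show "r \<odot>\<^bsub>N\<^esub> a \<in> f ` A" if "r \<in> carrier R" "a \<in> f ` A" for r a
  proof -
    from that obtain u where "u \<in> A" "a = f u" by auto
    then show ?thesis using that A smult[of r u] dom.submodule_smult[OF assms, of r u] by (metis image_eqI subsetD)
  qed
qed

lemma preimage_submodule:
  assumes C: "submodule C R M" and B: "submodule B R N"
  shows "submodule {v \<in> C. f v \<in> B} R M"
  by (rule dom.submoduleI')
     (use C B dom.submodule_subset[OF C] in
       \<open>auto simp: zero add smult subset_iff intro: dom.submodule_zero dom.submodule_add
         dom.submodule_smult cod.submodule_zero cod.submodule_add cod.submodule_smult\<close>)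

lemma kernel_submodule:
  assumes C: "submodule C R M"
  shows "submodule {v \<in> C. f v = \<zero>\<^bsub>N\<^esub>} R M"
  using preimage_submodule[OF C cod.submodule_zero_set] by simp

text \<open>For \<open>A \<subseteq> B \<subseteq> C\<close>, equality of both the intersections with the kernel and the images
forces \<open>A = B\<close>. Hence the sum of the lengths of these two submodules is strictly increasing in \<open>A\<close>
and is an admissible rank function.\<close>

lemma sublength_rank_nullity_le:
  assumes C: "submodule C R M"
    and K: "sublength R M {v \<in> C. f v = \<zero>\<^bsub>N\<^esub>} = enat k"
    and I: "sublength R N (f ` C) = enat l"
  shows "sublength R M C \<le> enat (k + l)"
proof -
  define K where "K = {v \<in> C. f v = \<zero>\<^bsub>N\<^esub>}"
  have subK: "submodule K R M" unfolding K_def by (rule kernel_submodule[OF C])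
  have subI: "submodule (f ` C) R N" by (rule image_submodule[OF C])
  define a where "a A = the_enat (sublength R M (A \<inter> K))" for A
  define b where "b A = the_enat (sublength R N (f ` A))" for A
  have a: "sublength R M (A \<inter> K) = enat (a A)" "a A \<le> k" if "submodule A R M" for A
  proof -
    have "sublength R M (A \<inter> K) \<le> enat k"
      using dom.sublength_mono[OF dom.submodule_Int[OF that subK] subK] K by (simp add: K_def)
    then show "sublength R M (A \<inter> K) = enat (a A)" "a A \<le> k"
      unfolding a_def using enat_ile by force+
  qed
  have b: "sublength R N (f ` A) = enat (b A)" "b A \<le> l" if "submodule A R M" "A \<subseteq> C" for A
  proof -
    have "sublength R N (f ` A) \<le> enat l"
      using cod.sublength_mono[OF image_submodule[OF that(1)] subI] that I by auto
    then show "sublength R N (f ` A) = enat (b A)" "b A \<le> l"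
      unfolding b_def using enat_ile by force+
  qed
  show ?thesis
  proof (rule dom.sublength_le_rank[OF C, of "\<lambda>A. a A + b A"])
    fix A B assume A: "submodule A R M" and B: "submodule B R M" and AB: "A \<subset> B" and BC: "B \<subseteq> C"
    have le1: "a A \<le> a B"
      using dom.sublength_mono[OF dom.submodule_Int[OF A subK] dom.submodule_Int[OF B subK]] AB
        a(1)[OF A] a(1)[OF B] by auto
    have le2: "b A \<le> b B"
      using cod.sublength_mono[OF image_submodule[OF A] image_submodule[OF B]] AB BC
        b(1)[OF A] b(1)[OF B] by auto
    have "A \<inter> K \<noteq> B \<inter> K \<or> f ` A \<noteq> f ` B"
    proof (rule ccontr)
      assume "\<not> ?thesis"
      then have eq: "A \<inter> K = B \<inter> K" "f ` A = f ` B" by auto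
      have "v \<in> A" if v: "v \<in> B" for v
      proof -
        obtain u where u: "u \<in> A" "f v = f u" using v eq(2) by (metis imageE image_eqI)
        have c: "u \<in> carrier M" "v \<in> carrier M"
          using u v dom.submodule_subset[OF A] dom.submodule_subset[OF B] by auto
        have "v \<ominus>\<^bsub>M\<^esub> u \<in> B" using dom.submodule_minus[OF B] u v AB by auto
        moreover have "f (v \<ominus>\<^bsub>M\<^esub> u) = \<zero>\<^bsub>N\<^esub>"
          using minus[OF c(2) c(1)] u closed[OF c(1)] by (simp add: a_minus_def cod.M.r_neg)
        ultimately have "v \<ominus>\<^bsub>M\<^esub> u \<in> A" using eq(1) BC K_def by auto
        then have "(v \<ominus>\<^bsub>M\<^esub> u) \<oplus>\<^bsub>M\<^esub> u \<in> A" using u dom.submodule_add[OF A] by auto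
        then show "v \<in> A" using c by (simp add: a_minus_def dom.M.a_assoc dom.M.l_neg)
      qed
      with AB show False by auto
    qed
    then consider "A \<inter> K \<subset> B \<inter> K" | "f ` A \<subset> f ` B" using AB by blast
    then show "a A + b A < a B + b B"
    proof cases
      case 1
      from dom.sublength_strict_mono[OF dom.submodule_Int[OF A subK] dom.submodule_Int[OF B subK] this]
      have "a A < a B" using a(1)[OF A] a(1)[OF B] by (simp add: eSuc_enat)
      then show ?thesis using le2 by simp
    next
      case 2
      from cod.sublength_strict_mono[OF image_submodule[OF A] image_submodule[OF B] this]
      have "b A < b B" using b(1)[OF A] b(1)[OF B] AB BC by (simp add: eSuc_enat)
      then show ?thesis using le1 by simp
    qed
  qed (use a b in \<open>auto intro: add_mono\<close>)
qed

text \<open>A chain in the kernel is continued by the preimages of a chain in the image.\<close>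

lemma sublength_rank_nullity_ge:
  assumes C: "submodule C R M"
    and K: "enat k \<le> sublength R M {v \<in> C. f v = \<zero>\<^bsub>N\<^esub>}"
    and I: "enat l \<le> sublength R N (f ` C)"
  shows "enat (k + l) \<le> sublength R M C"
proof -
  obtain P where P: "submodule_chain R M {v \<in> C. f v = \<zero>\<^bsub>N\<^esub>} k P"
    using K dom.sublength_ge_iff[OF kernel_submodule[OF C]] by auto
  obtain Q where Q: "submodule_chain R N (f ` C) l Q"
    using I cod.sublength_ge_iff[OF image_submodule[OF C]] by auto
  define pre where "pre i = {v \<in> C. f v \<in> Q i}" for i
  have pre_sub: "submodule (pre i) R M" if "i \<le> l" for i
    unfolding pre_def by (rule preimage_submodule[OF C]) (use Q that in \<open>auto simp: submodule_chain_def\<close>)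
  have pre_strict: "pre i \<subset> pre (Suc i)" if "i < l" for i
  proof -
    have "Q i \<subset> Q (Suc i)" "Q (Suc i) \<subseteq> f ` C" using Q that by (auto simp: submodule_chain_def)
    then show ?thesis unfolding pre_def by blast
  qed
  have "P k \<subseteq> pre 0"
  proof -
    have "\<zero>\<^bsub>N\<^esub> \<in> Q 0" using Q cod.submodule_zero by (auto simp: submodule_chain_def)
    moreover have "P k \<subseteq> {v \<in> C. f v = \<zero>\<^bsub>N\<^esub>}" using P by (simp add: submodule_chain_def)
    ultimately show ?thesis by (auto simp: pre_def)
  qed
  define N' where "N' i = (if i \<le> k then P i else pre (i - k))" for i
  have "submodule_chain R M C (k + l) N'"
    unfolding submodule_chain_def
  proof (intro conjI allI impI)
    fix i assume i: "i \<le> k + l"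
    show "submodule (N' i) R M" "N' i \<subseteq> C"
      using P pre_sub i by (auto simp: N'_def submodule_chain_def pre_def)
  next
    fix i assume i: "i < k + l"
    consider "i < k" | "i = k" | "i > k" by linarith
    then show "N' i \<subset> N' (Suc i)"
    proof cases
      case 1
      then show ?thesis using P by (auto simp: N'_def submodule_chain_def)
    next
      case 2
      then show ?thesis using \<open>P k \<subseteq> pre 0\<close> pre_strict[of 0] i by (auto simp: N'_def)
    next
      case 3
      then show ?thesis using pre_strict[of "i - k"] i by (simp add: N'_def Suc_diff_le)
    qed
  qed
  then show ?thesis using dom.sublength_ge_iff[OF C] by blast
qed

theorem sublength_rank_nullity:
  assumes C: "submodule C R M"
  shows "sublength R M C = sublength R M {v \<in> C. f v = \<zero>\<^bsub>N\<^esub>} + sublength R N (f ` C)"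
    (is "?c = ?k + ?i")
proof (rule antisym)
  show "?c \<le> ?k + ?i"
    using sublength_rank_nullity_le[OF C] by (cases ?k; cases ?i) auto
  show "?k + ?i \<le> ?c"
  proof (rule ccontr)
    assume "\<not> ?thesis"
    then have less: "?c < ?k + ?i" by (simp only: not_le)
    then obtain c where c: "?c = enat c" by (cases ?c) auto
    have lt: "enat (Suc c) \<le> ?k + ?i" using less unfolding c by (simp only: Suc_ile_eq)
    have "\<exists>k l. enat k \<le> ?k \<and> enat l \<le> ?i \<and> Suc c \<le> k + l"
    proof (cases "?k = \<infinity>")
      case True
      then show ?thesis by (intro exI[of _ "Suc c"] exI[of _ 0]) (auto simp: zero_enat_def[symmetric])
    next
      case False
      then obtain k where k: "?k = enat k" by auto
      show ?thesis
      proof (cases ?i)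
        case (enat l)
        then show ?thesis using k lt by (intro exI[of _ k] exI[of _ l]) auto
      next
        case infinity
        then show ?thesis by (intro exI[of _ 0] exI[of _ "Suc c"]) (auto simp: zero_enat_def[symmetric])
      qed
    qed
    then obtain k l where "enat k \<le> ?k" "enat l \<le> ?i" "Suc c \<le> k + l" by blast
    then show False using sublength_rank_nullity_ge[OF C, of k l] c by simp
  qed
qed

end

section \<open>Ideals and units of a local Artinian ring\<close>

lemma regular_module_simps [simp]:
  "carrier (regular_module R) = carrier R"
  "add (regular_module R) = add R"
  "zero (regular_module R) = zero R"
  "smult (regular_module R) = mult R"
  by (simp_all add: regular_module_def)

lemma sublength_regular_carrier: "sublength R (regular_module R) (carrier R) = module_length R (regular_module R)"
  by (simp add: regular_module_def)

definition (in module) adjoin :: "'c set \<Rightarrow> 'a set \<Rightarrow> 'c \<Rightarrow> 'c set"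
  where "adjoin A I d = {a \<oplus>\<^bsub>M\<^esub> r \<odot>\<^bsub>M\<^esub> d | a r. a \<in> A \<and> r \<in> I}"

lemma (in module) adjoin_submodule:
  assumes A: "submodule A R M" and I: "ideal I R" and d: "d \<in> carrier M"
  shows "submodule (adjoin A I d) R M"
proof -
  interpret I: ideal I R by (rule I)
  note Ac = subsetD[OF submodule_subset[OF A]]
  show ?thesis
  proof (rule submoduleI')
    show "adjoin A I d \<subseteq> carrier M" using Ac d by (auto simp: adjoin_def)
    have "\<zero>\<^bsub>M\<^esub> = \<zero>\<^bsub>M\<^esub> \<oplus>\<^bsub>M\<^esub> \<zero> \<odot>\<^bsub>M\<^esub> d" using d by simp
    then show "\<zero>\<^bsub>M\<^esub> \<in> adjoin A I d"
      unfolding adjoin_def using submodule_zero[OF A] I.zero_closed by blast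
  next
    fix x y assume "x \<in> adjoin A I d" "y \<in> adjoin A I d"
    then obtain a b r s where h: "x = a \<oplus>\<^bsub>M\<^esub> r \<odot>\<^bsub>M\<^esub> d" "y = b \<oplus>\<^bsub>M\<^esub> s \<odot>\<^bsub>M\<^esub> d"
      "a \<in> A" "b \<in> A" "r \<in> I" "s \<in> I" unfolding adjoin_def by blast
    have "x \<oplus>\<^bsub>M\<^esub> y = (a \<oplus>\<^bsub>M\<^esub> b) \<oplus>\<^bsub>M\<^esub> (r \<oplus> s) \<odot>\<^bsub>M\<^esub> d"
      using h Ac d by (simp add: smult_l_distr M.a_ac)
    then show "x \<oplus>\<^bsub>M\<^esub> y \<in> adjoin A I d"
      unfolding adjoin_def using submodule_add[OF A h(3,4)] I.a_closed[OF h(5,6)] by blast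
  next
    fix t x assume t: "t \<in> carrier R" and "x \<in> adjoin A I d"
    then obtain a r where h: "x = a \<oplus>\<^bsub>M\<^esub> r \<odot>\<^bsub>M\<^esub> d" "a \<in> A" "r \<in> I" unfolding adjoin_def by blast
    have "t \<odot>\<^bsub>M\<^esub> x = t \<odot>\<^bsub>M\<^esub> a \<oplus>\<^bsub>M\<^esub> (t \<otimes> r) \<odot>\<^bsub>M\<^esub> d"
      using h Ac d t by (simp add: smult_r_distr smult_assoc1)
    then show "t \<odot>\<^bsub>M\<^esub> x \<in> adjoin A I d"
      unfolding adjoin_def using submodule_smult[OF A t h(2)] I.I_l_closed[OF h(3) t] by blast
  qed
qed

lemma (in module) subset_adjoin:
  assumes A: "submodule A R M" and I: "ideal I R" and d: "d \<in> carrier M"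
  shows "A \<subseteq> adjoin A I d"
proof
  interpret I: ideal I R by (rule I)
  fix a assume a: "a \<in> A"
  then have "a = a \<oplus>\<^bsub>M\<^esub> \<zero> \<odot>\<^bsub>M\<^esub> d" using d submodule_subset[OF A] by auto
  then show "a \<in> adjoin A I d" unfolding adjoin_def using a I.zero_closed by blast
qed

lemma (in module) smult_mem_adjoin:
  assumes A: "submodule A R M" and I: "ideal I R" and d: "d \<in> carrier M" and r: "r \<in> I"
  shows "r \<odot>\<^bsub>M\<^esub> d \<in> adjoin A I d"
proof -
  interpret I: ideal I R by (rule I)
  have "r \<odot>\<^bsub>M\<^esub> d = \<zero>\<^bsub>M\<^esub> \<oplus>\<^bsub>M\<^esub> r \<odot>\<^bsub>M\<^esub> d" using d r by simp
  then show ?thesis unfolding adjoin_def using r submodule_zero[OF A] by blast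
qed

lemma (in module) adjoin_subset:
  assumes D: "submodule D R M" and "A \<subseteq> D" "I \<subseteq> carrier R" "d \<in> D"
  shows "adjoin A I d \<subseteq> D"
  unfolding adjoin_def using assms submodule_add[OF D] submodule_smult[OF D] by blast

lemma (in cring) submodule_regular_iff: "submodule I R (regular_module R) \<longleftrightarrow> ideal I R"
proof
  interpret M: module R "regular_module R" by (rule regular_module_is_module)
  assume I: "submodule I R (regular_module R)"
  show "ideal I R"
  proof (rule idealI[OF ring_axioms])
    have sub: "I \<subseteq> carrier R" using M.submodule_subset[OF I] by simp
    show "subgroup I (add_monoid R)"
    proof (rule add.subgroupI)
      show "I \<noteq> {}" using M.submodule_zero[OF I] by auto
      fix a assume a: "a \<in> I"
      have "(\<ominus> \<one>) \<otimes> a \<in> I" using M.submodule_smult[OF I, of "\<ominus> \<one>" a] a by simp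
      then show "\<ominus> a \<in> I" using a sub by (simp add: l_minus subset_iff)
      fix b assume "b \<in> I"
      then show "a \<oplus> b \<in> I" using M.submodule_add[OF I] a by simp
    qed (rule sub)
    show l: "x \<otimes> a \<in> I" if "a \<in> I" "x \<in> carrier R" for a x
      using M.submodule_smult[OF I] that by simp
    show "a \<otimes> x \<in> I" if "a \<in> I" "x \<in> carrier R" for a x
      using l[OF that] that sub by (simp add: m_comm subset_iff)
  qed
next
  interpret M: module R "regular_module R" by (rule regular_module_is_module)
  assume "ideal I R"
  then interpret I: ideal I R .
  show "submodule I R (regular_module R)"
    by (rule M.submoduleI') (auto intro: I.I_l_closed)
qed

text \<open>Zorn's lemma for ideals. It is used with \<open>x = 1\<close>, to find maximal ideals, and with \<open>x\<close> in an
ideal killed by \<open>\<mm>\<close>, where \<open>N\<close> becomes a hyperplane.\<close>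

lemma (in cring) exists_ideal_maximal_avoiding:
  assumes I: "ideal I R" and x: "x \<notin> I"
  obtains N where "ideal N R" "I \<subseteq> N" "x \<notin> N"
    "\<And>L. ideal L R \<Longrightarrow> N \<subseteq> L \<Longrightarrow> x \<notin> L \<Longrightarrow> L = N"
proof -
  define \<A> where "\<A> = {N. ideal N R \<and> I \<subseteq> N \<and> x \<notin> N}"
  have "\<exists>M\<in>\<A>. \<forall>X\<in>\<A>. M \<subseteq> X \<longrightarrow> X = M"
  proof (rule subset_Zorn_nonempty)
    show "\<A> \<noteq> {}" using I x by (auto simp: \<A>_def)
    fix \<C> assume ne: "\<C> \<noteq> {}" and ch: "subset.chain \<A> \<C>"
    then have "subset.chain {I. ideal I R} \<C>" by (auto simp: subset_chain_def \<A>_def)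
    from chain_Union_is_ideal[OF this] have "ideal (\<Union>\<C>) R" using ne by simp
    then show "\<Union>\<C> \<in> \<A>" using ne ch by (auto simp: subset_chain_def \<A>_def)
  qed
  then obtain N where N: "N \<in> \<A>" "\<And>X. X \<in> \<A> \<Longrightarrow> N \<subseteq> X \<Longrightarrow> X = N" by blast
  show thesis
    by (rule that[of N]) (use N in \<open>auto simp: \<A>_def\<close>)
qed

context local_artinian_ring
begin

lemma m_subset: "\<mm> \<subseteq> carrier R"
  by auto

lemma one_notin_m: "\<one> \<notin> \<mm>"
  using I_notcarr one_imp_carrier by auto

lemma unit_if_notin_m:
  assumes x: "x \<in> carrier R" "x \<notin> \<mm>"
  shows "x \<in> Units R"
proof (rule ccontr)
  assume nu: "x \<notin> Units R"
  have "\<one> \<notin> PIdl x"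
  proof
    assume "\<one> \<in> PIdl x"
    then obtain y where "y \<in> carrier R" "\<one> = y \<otimes> x" by (auto simp: cgenideal_def)
    then show False using nu x m_comm by (auto simp: Units_def)
  qed
  then obtain N where N: "ideal N R" "PIdl x \<subseteq> N" "\<one> \<notin> N"
      and max: "\<And>L. ideal L R \<Longrightarrow> N \<subseteq> L \<Longrightarrow> \<one> \<notin> L \<Longrightarrow> L = N"
    using exists_ideal_maximal_avoiding[OF cgenideal_ideal[OF x(1)]] by metis
  have "maximalideal N R"
  proof (rule maximalidealI[OF N(1)])
    show "carrier R \<noteq> N" using N(3) by auto
    fix L assume "ideal L R" "N \<subseteq> L" "L \<subseteq> carrier R"
    then show "L = N \<or> L = carrier R" using max[of L] ideal.one_imp_carrier[of L R] by blast
  qed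
  then have "N = \<mm>" by (rule unique_maximal)
  then show False using N(2) cgenideal_self[OF x(1)] x(2) by auto
qed

lemma one_minus_unit:
  assumes "r \<in> \<mm>"
  shows "\<one> \<ominus> r \<in> Units R"
proof (rule unit_if_notin_m)
  have r: "r \<in> carrier R" using assms by auto
  show "\<one> \<ominus> r \<in> carrier R" using r by simp
  show "\<one> \<ominus> r \<notin> \<mm>"
  proof
    assume "\<one> \<ominus> r \<in> \<mm>"
    then have "(\<one> \<ominus> r) \<oplus> r \<in> \<mm>" using assms by simp
    moreover have "(\<one> \<ominus> r) \<oplus> r = \<one>" using r by (simp add: a_minus_def a_assoc l_neg)
    ultimately show False using one_notin_m by simp
  qed
qed

lemma exists_minimal_ideal:
  assumes ideal: "\<And>I. P I \<Longrightarrow> ideal I R" and P: "P I0"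
  obtains J where "P J" "\<And>I. P I \<Longrightarrow> I \<subseteq> J \<Longrightarrow> I = J"
proof -
  have "\<exists>J. P J \<and> (\<forall>I. P I \<longrightarrow> I \<subseteq> J \<longrightarrow> I = J)"
  proof (rule ccontr)
    assume no: "\<not> ?thesis"
    have "\<exists>f. \<forall>n::nat. P (f n) \<and> f (Suc n) \<subset> f n"
      by (rule dependent_nat_choice) (use P no in blast)+
    then obtain f where f: "\<And>n::nat. P (f n)" "\<And>n. f (Suc n) \<subset> f n" by blast
    obtain N where N: "\<forall>k\<ge>N. f k = f N"
      using descending_chain[of f] ideal f by blast
    have "f (Suc N) = f N" by (rule N[rule_format]) simp
    then show False using f(2)[of N] by simp
  qed
  then show thesis using that by blast
qed

text \<open>If \<open>R r^N = R r^(N + 1)\<close>, then \<open>(1 - s r) r^N = 0\<close> for some \<open>s\<close>, and \<open>1 - s r\<close> is a unit.\<close>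

lemma m_nil:
  assumes r: "r \<in> \<mm>"
  obtains k :: nat where "r [^] k = \<zero>"
proof -
  have rc: "r \<in> carrier R" using r by auto
  obtain N :: nat where N: "\<And>k. k \<ge> N \<Longrightarrow> PIdl (r [^] k) = PIdl (r [^] N)"
  proof -
    have "\<exists>N::nat. \<forall>k\<ge>N. PIdl (r [^] k) = PIdl (r [^] N)"
    proof (rule descending_chain[of "\<lambda>k. PIdl (r [^] k)"])
      show "ideal (PIdl (r [^] k)) R" for k :: nat using rc by (simp add: cgenideal_ideal)
      show "PIdl (r [^] (Suc k)) \<subseteq> PIdl (r [^] k)" for k :: nat
      proof (rule cgenideal_minimal)
        show "ideal (PIdl (r [^] k)) R" using rc by (simp add: cgenideal_ideal)
        show "r [^] Suc k \<in> PIdl (r [^] k)"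
          using rc by (auto simp: cgenideal_def m_comm intro!: exI[of _ r])
      qed
    qed
    then show thesis using that by blast
  qed
  have "r [^] N \<in> PIdl (r [^] (Suc N))"
    using N[of "Suc N"] cgenideal_self[of "r [^] N"] rc by simp
  then obtain s where s: "s \<in> carrier R" and eq: "r [^] N = s \<otimes> (r [^] N \<otimes> r)"
    using rc by (auto simp: cgenideal_def)
  have u: "\<one> \<ominus> s \<otimes> r \<in> Units R" using one_minus_unit[of "s \<otimes> r"] r s I_l_closed by blast
  have "(\<one> \<ominus> s \<otimes> r) \<otimes> r [^] N = r [^] N \<ominus> (s \<otimes> r) \<otimes> r [^] N"
    using s rc by (simp add: a_minus_def l_distr l_minus)
  also have "(s \<otimes> r) \<otimes> r [^] N = s \<otimes> (r [^] N \<otimes> r)"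
    using s rc by (simp add: m_ac)
  also have "r [^] N \<ominus> s \<otimes> (r [^] N \<otimes> r) = \<zero>"
    unfolding eq[symmetric] using rc by (simp add: a_minus_def r_neg)
  finally have "(\<one> \<ominus> s \<otimes> r) \<otimes> r [^] N = \<zero>" .
  then have "r [^] N = \<zero>" using u rc by (metis Units_l_cancel Units_closed nat_pow_closed r_null zero_closed)
  then show thesis by (rule that)
qed

section \<open>Submodules one step apart\<close>

text \<open>If \<open>D = A + R d\<close> with \<open>\<mm> d \<subseteq> A\<close>, then \<open>D/A\<close> is cyclic over the residue field, so its
length is at most one. As a rank function on submodules \<open>N\<close> of \<open>D\<close> serves the length of
\<open>N \<inter> A\<close>, increased by one unless \<open>N \<subseteq> A\<close>: once \<open>N\<close> contains some \<open>b + r d\<close> outside \<open>A\<close>,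
\<open>r\<close> is a unit, and every larger \<open>N'\<close> is determined by \<open>N' \<inter> A\<close>.\<close>

lemma sublength_step_le:
  fixes M (structure)
  assumes "module R M" and A: "submodule A R M" and D: "submodule D R M"
    and d: "d \<in> D"
    and gen: "\<And>x. x \<in> D \<Longrightarrow> \<exists>a\<in>A. \<exists>r\<in>carrier R. x = a \<oplus>\<^bsub>M\<^esub> r \<odot>\<^bsub>M\<^esub> d"
    and md: "\<And>r. r \<in> \<mm> \<Longrightarrow> r \<odot>\<^bsub>M\<^esub> d \<in> A"
  shows "sublength R M D \<le> eSuc (sublength R M A)"
proof (cases "sublength R M A")
  case (enat k)
  interpret module R M by fact
  define a where "a N = the_enat (sublength R M (N \<inter> A))" for N
  have a: "sublength R M (N \<inter> A) = enat (a N)" "a N \<le> k" if "submodule N R M" for N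
  proof -
    have "sublength R M (N \<inter> A) \<le> enat k"
      using sublength_mono[OF submodule_Int[OF that A] A] enat by simp
    then show "sublength R M (N \<inter> A) = enat (a N)" "a N \<le> k"
      unfolding a_def using enat_ile by force+
  qed
  have "sublength R M D \<le> enat (Suc k)"
  proof (rule sublength_le_rank[OF D, of "\<lambda>N. a N + (if N \<subseteq> A then 0 else 1)"])
    fix N N' assume N: "submodule N R M" "submodule N' R M" "N \<subset> N'" "N' \<subseteq> D"
    have le: "a N \<le> a N'"
      using sublength_mono[OF submodule_Int[OF N(1) A] submodule_Int[OF N(2) A]] N(3)
        a(1)[OF N(1)] a(1)[OF N(2)] by auto
    show "a N + (if N \<subseteq> A then 0 else 1) < a N' + (if N' \<subseteq> A then 0 else 1)"
    proof (cases "N \<inter> A = N' \<inter> A")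
      case False
      then have "N \<inter> A \<subset> N' \<inter> A" using N(3) by blast
      from sublength_strict_mono[OF submodule_Int[OF N(1) A] submodule_Int[OF N(2) A] this]
      have "a N < a N'" using a(1)[OF N(1)] a(1)[OF N(2)] by (simp add: eSuc_enat)
      then show ?thesis using N(3) by auto
    next
      case True
      have "N \<subseteq> A"
      proof (rule ccontr)
        assume "\<not> N \<subseteq> A"
        then obtain y where y: "y \<in> N" "y \<notin> A" by auto
        then obtain b r where b: "b \<in> A" and r: "r \<in> carrier R" and yeq: "y = b \<oplus>\<^bsub>M\<^esub> r \<odot>\<^bsub>M\<^esub> d"
          using gen[of y] N by blast
        have "r \<notin> \<mm>" using md[of r] y yeq submodule_add[OF A b] by auto
        then have u: "r \<in> Units R" using r by (rule unit_if_notin_m[rotated])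
        have "x \<in> N" if x: "x \<in> N'" for x
        proof -
          obtain c s where c: "c \<in> A" and s: "s \<in> carrier R" and xeq: "x = c \<oplus>\<^bsub>M\<^esub> s \<odot>\<^bsub>M\<^esub> d"
            using gen[of x] x N by blast
          \<comment> \<open>The multiple \<open>t y\<close> cancels the \<open>d\<close>-component of \<open>x\<close>.\<close>
          define t where "t = s \<otimes> inv r"
          have t: "t \<in> carrier R" and tr: "t \<otimes> r = s"
            using s u r by (simp_all add: t_def m_assoc)
          have cl: "b \<in> carrier M" "c \<in> carrier M" "d \<in> carrier M" "y \<in> carrier M" "x \<in> carrier M"
            using b c d y x submodule_subset[OF A] submodule_subset[OF D]
              submodule_subset[OF N(1)] submodule_subset[OF N(2)] by auto
          have ty: "t \<odot>\<^bsub>M\<^esub> y = t \<odot>\<^bsub>M\<^esub> b \<oplus>\<^bsub>M\<^esub> s \<odot>\<^bsub>M\<^esub> d"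
            using cl t r by (simp add: yeq smult_r_distr smult_assoc1[symmetric] tr)
          have "x \<ominus>\<^bsub>M\<^esub> t \<odot>\<^bsub>M\<^esub> y = c \<ominus>\<^bsub>M\<^esub> t \<odot>\<^bsub>M\<^esub> b"
            unfolding ty xeq using cl t s
            by (simp add: a_minus_def M.minus_add M.a_ac M.r_neg)
               (simp add: M.a_assoc[symmetric] M.r_neg M.l_neg)
          then have "x \<ominus>\<^bsub>M\<^esub> t \<odot>\<^bsub>M\<^esub> y \<in> A"
            using submodule_minus[OF A c submodule_smult[OF A t b]] by simp
          moreover have ty': "t \<odot>\<^bsub>M\<^esub> y \<in> N" using submodule_smult[OF N(1) t y(1)] .
          then have "x \<ominus>\<^bsub>M\<^esub> t \<odot>\<^bsub>M\<^esub> y \<in> N'" using submodule_minus[OF N(2) x] N(3) by auto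
          ultimately have "x \<ominus>\<^bsub>M\<^esub> t \<odot>\<^bsub>M\<^esub> y \<in> N" using True by auto
          from submodule_add[OF N(1) this ty'] show "x \<in> N"
            using cl t by (simp add: a_minus_def M.a_assoc M.l_neg)
        qed
        then show False using N(3) by auto
      qed
      moreover have "\<not> N' \<subseteq> A" using True N(3) \<open>N \<subseteq> A\<close> by auto
      ultimately show ?thesis using le by simp
    qed
  next
    fix N assume "submodule N R M" "N \<subseteq> D"
    then show "a N + (if N \<subseteq> A then 0 else 1) \<le> Suc k" using a(2)[of N] by simp
  qed
  then show ?thesis using enat by (simp add: eSuc_enat)
qed simp

text \<open>Take \<open>B\<close> of maximal length among the proper submodules of \<open>D\<close> above \<open>A\<close>, so that nothing lies
strictly between \<open>B\<close> and \<open>D\<close>, and any \<open>d\<close> in \<open>D\<close> outside \<open>B\<close>. Then \<open>B + R d = D\<close>, while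
\<open>B + \<mm> d\<close> misses \<open>d\<close> (Nakayama's argument) and hence equals \<open>B\<close>.\<close>

lemma exists_submodule_step:
  fixes M (structure)
  assumes "module R M" and A: "submodule A R M" and D: "submodule D R M" and AD: "A \<subset> D"
    and fin: "sublength R M D = enat l"
  obtains B d where "submodule B R M" "A \<subseteq> B" "B \<subset> D" "d \<in> D"
    "\<And>x. x \<in> D \<Longrightarrow> \<exists>a\<in>B. \<exists>r\<in>carrier R. x = a \<oplus>\<^bsub>M\<^esub> r \<odot>\<^bsub>M\<^esub> d"
    "\<And>r. r \<in> \<mm> \<Longrightarrow> r \<odot>\<^bsub>M\<^esub> d \<in> B"
proof -
  interpret module R M by fact
  define P where "P B \<longleftrightarrow> submodule B R M \<and> A \<subseteq> B \<and> B \<subset> D" for B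
  define f where "f B = the_enat (sublength R M B)" for B
  have f: "sublength R M B = enat (f B)" "f B \<le> l" if "P B" for B
  proof -
    have "sublength R M B \<le> enat l"
      using sublength_mono[of B D] that D fin by (auto simp: P_def)
    then show "sublength R M B = enat (f B)" "f B \<le> l" unfolding f_def using enat_ile by force+
  qed
  have "P A" using A AD by (simp add: P_def)
  then obtain B where B: "P B" and max: "\<And>X. P X \<Longrightarrow> f X \<le> f B"
    using ex_has_greatest_nat[of P A f "Suc l"] f(2) by (metis le_imp_less_Suc)
  have subB: "submodule B R M" and AB: "A \<subseteq> B" and BD: "B \<subset> D" using B by (auto simp: P_def)
  have no_between: "X = B" if "submodule X R M" "B \<subseteq> X" "X \<subset> D" for X
  proof (rule ccontr)
    assume "X \<noteq> B"
    then have "B \<subset> X" using that by auto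
    have "P X" using that AB by (auto simp: P_def)
    have "eSuc (sublength R M B) \<le> sublength R M X"
      by (rule sublength_strict_mono) fact+
    then have "f B < f X" using f(1)[OF B] f(1)[OF \<open>P X\<close>] by (simp add: eSuc_enat)
    then show False using max[OF \<open>P X\<close>] by simp
  qed
  from BD obtain d where d: "d \<in> D" "d \<notin> B" by auto
  have dc: "d \<in> carrier M" using d submodule_subset[OF D] by auto
  have mi: "ideal \<mm> R" by (rule ideal_axioms)
  define X where "X = adjoin B (carrier R) d"
  define Y where "Y = adjoin B \<mm> d"
  have X: "submodule X R M" "B \<subseteq> X" "X \<subseteq> D" "d \<in> X"
    unfolding X_def using adjoin_submodule[OF subB oneideal dc] subset_adjoin[OF subB oneideal dc]
      adjoin_subset[OF D] BD d smult_mem_adjoin[OF subB oneideal dc, of \<one>] dc by auto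
  have Y: "submodule Y R M" "B \<subseteq> Y" "Y \<subseteq> D"
    unfolding Y_def using adjoin_submodule[OF subB mi dc] subset_adjoin[OF subB mi dc]
      adjoin_subset[OF D] BD d m_subset by auto
  have "X = D" using no_between[of X] X d by blast
  have "d \<notin> Y"
  proof
    assume "d \<in> Y"
    then obtain b r where b: "b \<in> B" and r: "r \<in> \<mm>" and eq: "d = b \<oplus>\<^bsub>M\<^esub> r \<odot>\<^bsub>M\<^esub> d"
      by (auto simp: Y_def adjoin_def)
    have rc: "r \<in> carrier R" using r by auto
    have bc: "b \<in> carrier M" using b submodule_subset[OF subB] by auto
    have u: "\<one> \<ominus> r \<in> Units R" by (rule one_minus_unit[OF r])
    have "(\<one> \<ominus> r) \<odot>\<^bsub>M\<^esub> d = d \<ominus>\<^bsub>M\<^esub> r \<odot>\<^bsub>M\<^esub> d"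
      using rc dc by (simp add: a_minus_def smult_l_distr smult_l_minus)
    also have "\<dots> = (b \<oplus>\<^bsub>M\<^esub> r \<odot>\<^bsub>M\<^esub> d) \<ominus>\<^bsub>M\<^esub> r \<odot>\<^bsub>M\<^esub> d" using eq by simp
    also have "\<dots> = b" using bc rc dc by (simp add: a_minus_def M.a_assoc M.r_neg)
    finally have eqb: "(\<one> \<ominus> r) \<odot>\<^bsub>M\<^esub> d = b" .
    have "d = (inv (\<one> \<ominus> r) \<otimes> (\<one> \<ominus> r)) \<odot>\<^bsub>M\<^esub> d" using u dc by simp
    also have "\<dots> = inv (\<one> \<ominus> r) \<odot>\<^bsub>M\<^esub> b"
      using smult_assoc1[of "inv (\<one> \<ominus> r)" "\<one> \<ominus> r" d] u dc rc by (simp only: eqb Units_inv_closed Units_closed)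
    finally have "d \<in> B" using submodule_smult[OF subB _ b, of "inv (\<one> \<ominus> r)"] u by auto
    then show False using d by simp
  qed
  then have "Y = B" using no_between[of Y] Y d by blast
  show thesis
  proof (rule that[of B d])
    show "\<exists>a\<in>B. \<exists>r\<in>carrier R. x = a \<oplus>\<^bsub>M\<^esub> r \<odot>\<^bsub>M\<^esub> d" if "x \<in> D" for x
      using that unfolding \<open>X = D\<close>[symmetric] X_def adjoin_def by blast
    show "r \<odot>\<^bsub>M\<^esub> d \<in> B" if "r \<in> \<mm>" for r
      using smult_mem_adjoin[OF subB mi dc that] \<open>Y = B\<close> by (simp add: Y_def)
  qed (use subB AB BD d in auto)
qed

section \<open>A local Artinian ring has finite length\<close>

lemma mult_linear_map:
  assumes "r \<in> carrier R"
  shows "linear_map R (regular_module R) (regular_module R) (\<lambda>x. r \<otimes> x)"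
proof -
  interpret M: module R "regular_module R" by (rule regular_module_is_module)
  show ?thesis
    by unfold_locales (use assms in \<open>auto simp: r_distr m_lcomm\<close>)
qed

text \<open>Otherwise let \<open>J\<close> be minimal among the ideals of infinite length; all smaller ideals have finite
length. Multiplication by \<open>r\<close> maps \<open>J\<close> onto \<open>r J\<close>, so by rank-nullity the kernel or the image is
all of \<open>J\<close>. For \<open>r \<in> \<mm>\<close> the image cannot be, since \<open>r\<close> is nilpotent; hence \<open>\<mm> J = 0\<close>. A
vector space over the residue field has a hyperplane: an ideal \<open>N\<close> maximal among those avoiding a
nonzero \<open>x \<in> J\<close> satisfies \<open>J = (N \<inter> J) + R x\<close>. As \<open>N \<inter> J\<close> is smaller than \<open>J\<close>, it has finite
length, and then so has \<open>J\<close>.\<close>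

theorem module_length_regular_finite: "module_length R (regular_module R) \<noteq> \<infinity>"
proof
  assume inf: "module_length R (regular_module R) = \<infinity>"
  interpret M: module R "regular_module R" by (rule regular_module_is_module)
  let ?len = "sublength R (regular_module R)"
  obtain J where J: "ideal J R" "?len J = \<infinity>"
    and min: "\<And>I. ideal I R \<Longrightarrow> ?len I = \<infinity> \<Longrightarrow> I \<subseteq> J \<Longrightarrow> I = J"
  proof (rule exists_minimal_ideal[of "\<lambda>I. ideal I R \<and> ?len I = \<infinity>" "carrier R"])
    show "ideal (carrier R) R \<and> ?len (carrier R) = \<infinity>"
      using inf oneideal by (simp only: sublength_regular_carrier)
  qed blast+
  note sub = submodule_regular_iff
  have Jc: "J \<subseteq> carrier R" using J(1) by (simp add: ideal.Icarr subsetI)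
  have Jne: "J \<noteq> {\<zero>}" using J(2) M.sublength_zero_set by auto
  have dich: "(\<lambda>x. r \<otimes> x) ` J = J \<or> (\<forall>x\<in>J. r \<otimes> x = \<zero>)" if r: "r \<in> carrier R" for r
  proof -
    interpret f: linear_map R "regular_module R" "regular_module R" "\<lambda>x. r \<otimes> x"
      by (rule mult_linear_map[OF r])
    have sJ: "submodule J R (regular_module R)" using J(1) sub by simp
    have K: "ideal {v \<in> J. r \<otimes> v = \<zero>} R" using f.kernel_submodule[OF sJ] sub by simp
    have I: "ideal ((\<lambda>x. r \<otimes> x) ` J) R" using f.image_submodule[OF sJ] sub by simp
    have "?len J = ?len {v \<in> J. r \<otimes> v = \<zero>} + ?len ((\<lambda>x. r \<otimes> x) ` J)"
      using f.sublength_rank_nullity[OF sJ] by simp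
    then have "?len {v \<in> J. r \<otimes> v = \<zero>} = \<infinity> \<or> ?len ((\<lambda>x. r \<otimes> x) ` J) = \<infinity>"
      unfolding J(2) by (simp add: eq_commute[of \<infinity>] plus_eq_infty_iff_enat)
    moreover have "(\<lambda>x. r \<otimes> x) ` J \<subseteq> J" using ideal.I_l_closed[OF J(1)] r by auto
    ultimately consider "{v \<in> J. r \<otimes> v = \<zero>} = J" | "(\<lambda>x. r \<otimes> x) ` J = J"
      using min[OF K] min[OF I] by blast
    then show ?thesis by cases blast+
  qed
  have mJ: "r \<otimes> x = \<zero>" if r: "r \<in> \<mm>" and x: "x \<in> J" for r x
  proof (rule ccontr)
    assume "r \<otimes> x \<noteq> \<zero>"
    have rc: "r \<in> carrier R" using r by auto
    have im: "(\<lambda>x. r \<otimes> x) ` J = J" using dich[OF rc] \<open>r \<otimes> x \<noteq> \<zero>\<close> x by blast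
    have pow: "(\<lambda>x. r [^] k \<otimes> x) ` J = J" for k :: nat
    proof (induction k)
      case 0
      show ?case using Jc by (auto simp: image_iff subset_iff)
    next
      case (Suc k)
      have "(\<lambda>x. r [^] Suc k \<otimes> x) ` J = (\<lambda>x. r [^] k \<otimes> x) ` (\<lambda>x. r \<otimes> x) ` J"
        unfolding image_image by (rule image_cong) (use Jc rc in \<open>auto simp: m_assoc subset_iff\<close>)
      then show ?case using im Suc by simp
    qed
    obtain k :: nat where "r [^] k = \<zero>" using m_nil[OF r] by blast
    then have "J = (\<lambda>x. \<zero> \<otimes> x) ` J" using pow[of k] by simp
    also have "\<dots> \<subseteq> {\<zero>}" using Jc by auto
    finally have "J \<subseteq> {\<zero>}" .
    then show False using Jne additive_subgroup.zero_closed[OF ideal.axioms(1)[OF J(1)]] by auto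
  qed
  obtain x where x: "x \<in> J" "x \<noteq> \<zero>"
    using Jne additive_subgroup.zero_closed[OF ideal.axioms(1)[OF J(1)]] by auto
  obtain N where N: "ideal N R" "x \<notin> N"
    and max: "\<And>L. ideal L R \<Longrightarrow> N \<subseteq> L \<Longrightarrow> x \<notin> L \<Longrightarrow> L = N"
    using exists_ideal_maximal_avoiding[OF zeroideal, of x] x(2) by auto
  have NJ: "ideal (N \<inter> J) R" by (rule i_intersect[OF N(1) J(1)])
  have "?len J \<le> eSuc (?len (N \<inter> J))"
  proof (rule sublength_step_le[OF regular_module_is_module])
    show "submodule (N \<inter> J) R (regular_module R)" "submodule J R (regular_module R)"
      using NJ J(1) sub by auto
    show "x \<in> J" by (rule x)
    show "r \<odot>\<^bsub>regular_module R\<^esub> x \<in> N \<inter> J" if "r \<in> \<mm>" for r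
      using mJ[OF that x(1)] additive_subgroup.zero_closed[OF ideal.axioms(1)[OF NJ]] by simp
    fix y assume y: "y \<in> J"
    have xc: "x \<in> carrier R" "y \<in> carrier R" using x y Jc by auto
    show "\<exists>a\<in>N \<inter> J. \<exists>r\<in>carrier R. y = a \<oplus>\<^bsub>regular_module R\<^esub> r \<odot>\<^bsub>regular_module R\<^esub> x"
    proof (cases "y \<in> N")
      case True
      then show ?thesis using y xc by (intro bexI[of _ y] bexI[of _ \<zero>]) auto
    next
      case False
      have sN: "submodule N R (regular_module R)" using N sub by simp
      have yc': "y \<in> carrier (regular_module R)" using xc by simp
      let ?L = "M.adjoin N (carrier R) y"
      \<comment> \<open>By maximality of \<open>N\<close>, the larger ideal \<open>N + R y\<close> contains \<open>x\<close>.\<close>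
      have "ideal ?L R" using M.adjoin_submodule[OF sN oneideal yc'] sub by simp
      moreover have "N \<subseteq> ?L" using M.subset_adjoin[OF sN oneideal yc'] .
      moreover have "y \<in> ?L" using M.smult_mem_adjoin[OF sN oneideal yc', of \<one>] xc by simp
      ultimately have "x \<in> ?L" using max[of ?L] False by auto
      then obtain n r where n: "n \<in> N" and r: "r \<in> carrier R" and xeq: "x = n \<oplus> r \<otimes> y"
        by (auto simp: M.adjoin_def)
      have nc: "n \<in> carrier R" using n N(1) ideal.Icarr by metis
      have "r \<notin> \<mm>" using mJ[of r y] y xeq n N(2) nc by auto
      then have u: "r \<in> Units R" using r by (rule unit_if_notin_m[rotated])
      have nJ: "n \<in> J"
      proof -
        have "x \<ominus> r \<otimes> y \<in> J" using M.submodule_minus[of J x "r \<otimes> y"] J(1) sub x y r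
          by (simp add: a_minus_def a_inv_def m_inv_def ideal.I_l_closed)
        moreover have "x \<ominus> r \<otimes> y = n" using xeq nc r xc by (simp add: a_minus_def a_assoc r_neg)
        ultimately show ?thesis by simp
      qed
      have "inv r \<otimes> x = inv r \<otimes> n \<oplus> y"
        using u nc xc r by (simp add: xeq r_distr m_assoc[symmetric])
      then have "y = \<ominus> (inv r \<otimes> n) \<oplus> inv r \<otimes> x"
        using u nc xc by (simp add: r_neg1)
      moreover have "\<ominus> (inv r \<otimes> n) \<in> N \<inter> J"
        using ideal.I_l_closed[OF NJ, of n "inv r"] n nJ u
          additive_subgroup.a_inv_closed[OF ideal.axioms(1)[OF NJ]] by simp
      ultimately show ?thesis using u by auto
    qed
  qed
  then have "?len (N \<inter> J) = \<infinity>" using J(2) by (cases "?len (N \<inter> J)") (simp_all add: eSuc_enat)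
  then have "N \<inter> J = J" using min[OF NJ] by blast
  then show False using x N(2) by auto
qed

section \<open>The socle and the Frobenius property\<close>

text \<open>The generator is the element that corresponds to the unit of \<open>R/\<mm>\<close>.\<close>

lemma frobenius_imp_socle_generator:
  assumes "frobenius_ring R \<mm>"
  obtains s where "s \<in> socle R \<mm>" "\<And>t. t \<in> socle R \<mm> \<Longrightarrow> \<exists>r\<in>carrier R. t = r \<otimes> s"
proof -
  interpret M: module R "regular_module R" by (rule regular_module_is_module)
  note hom_add = ring_hom_add[OF rcos_ring_hom] and hom_mult = ring_hom_mult[OF rcos_ring_hom]
  let ?Q = "quotient_module R \<mm>"
  have Q: "carrier ?Q = carrier (R Quot \<mm>)"
    "\<And>r X. r \<odot>\<^bsub>?Q\<^esub> X = (\<mm> +> r) \<otimes>\<^bsub>R Quot \<mm>\<^esub> X"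
    by (simp_all add: quotient_module_def)
  obtain f where iso: "f \<in> iso (add_monoid (regular_module R\<lparr>carrier := socle R \<mm>\<rparr>)) (add_monoid ?Q)"
    and lin: "\<And>r x. r \<in> carrier R \<Longrightarrow> x \<in> socle R \<mm> \<Longrightarrow> f (r \<otimes> x) = r \<odot>\<^bsub>?Q\<^esub> f x"
    using assms unfolding frobenius_ring_def module_isomorphic_def by auto
  have bij: "bij_betw f (socle R \<mm>) (carrier (R Quot \<mm>))"
    using iso Q(1) by (simp add: iso_def)
  have "\<mm> +> \<one> \<in> carrier (R Quot \<mm>)" by (rule ring_hom_closed[OF rcos_ring_hom]) simp
  then obtain s where s: "s \<in> socle R \<mm>" "f s = \<mm> +> \<one>"
    using bij by (metis bij_betw_imp_surj_on imageE)
  show thesis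
  proof (rule that[OF s(1)])
    fix t assume t: "t \<in> socle R \<mm>"
    have "f t \<in> carrier (R Quot \<mm>)" using bij t by (auto simp: bij_betw_def)
    then obtain r where r: "r \<in> carrier R" "f t = \<mm> +> r"
      unfolding FactRing_def A_RCOSETS_def' by auto
    have rs: "r \<otimes> s \<in> socle R \<mm>" using M.submodule_smult[OF socle_is_submodule r(1) s(1)] by simp
    have "f (r \<otimes> s) = (\<mm> +> r) \<otimes>\<^bsub>R Quot \<mm>\<^esub> (\<mm> +> \<one>)"
      using lin[OF r(1) s(1)] s(2) Q(2) by simp
    also have "\<dots> = f t" using hom_mult[OF r(1) one_closed] r by simp
    finally have "r \<otimes> s = t" using bij rs t by (auto simp: bij_betw_def inj_on_def)
    then show "\<exists>r\<in>carrier R. t = r \<otimes> s" using r(1) by blast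
  qed
qed

lemma frobenius_imp_sublength_socle:
  assumes "frobenius_ring R \<mm>"
  shows "sublength R (regular_module R) (socle R \<mm>) \<le> 1"
proof -
  interpret M: module R "regular_module R" by (rule regular_module_is_module)
  obtain s where s: "s \<in> socle R \<mm>" "\<And>t. t \<in> socle R \<mm> \<Longrightarrow> \<exists>r\<in>carrier R. t = r \<otimes> s"
    using frobenius_imp_socle_generator[OF assms] by blast
  have "sublength R (regular_module R) (socle R \<mm>) \<le> eSuc (sublength R (regular_module R) {\<zero>})"
  proof (rule sublength_step_le[OF regular_module_is_module _ socle_is_submodule s(1)])
    show "submodule {\<zero>} R (regular_module R)" using M.submodule_zero_set by simp
    show "\<exists>a\<in>{\<zero>}. \<exists>r\<in>carrier R. x = a \<oplus>\<^bsub>regular_module R\<^esub> r \<odot>\<^bsub>regular_module R\<^esub> s"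
      if "x \<in> socle R \<mm>" for x
      using s(2)[OF that] s(1) by (auto simp: socle_def)
    show "r \<odot>\<^bsub>regular_module R\<^esub> s \<in> {\<zero>}" if "r \<in> \<mm>" for r
      using s(1) that by (simp add: socle_def)
  qed
  then show ?thesis using M.sublength_zero_set by (simp add: one_eSuc)
qed

text \<open>A socle of length one is generated by any nonzero \<open>s\<close> in it. The annihilator of \<open>s\<close> is \<open>\<mm>\<close>, so
the set of all \<open>r\<close> with \<open>r s = t\<close> is a coset of \<open>\<mm>\<close>; sending \<open>t\<close> to it is the isomorphism onto
\<open>R/\<mm>\<close>.\<close>

lemma frobenius_if_sublength_socle:
  assumes len: "sublength R (regular_module R) (socle R \<mm>) = 1"
  shows "frobenius_ring R \<mm>"
proof -
  interpret M: module R "regular_module R" by (rule regular_module_is_module)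
  note hom_add = ring_hom_add[OF rcos_ring_hom] and hom_mult = ring_hom_mult[OF rcos_ring_hom]
  have "socle R \<mm> \<noteq> {\<zero>}" using len M.sublength_zero_set by (metis regular_module_simps(3) zero_neq_one)
  then obtain s where s: "s \<in> socle R \<mm>" "s \<noteq> \<zero>"
    using M.submodule_zero[OF socle_is_submodule] by auto
  have sc: "s \<in> carrier R" using s by (simp add: socle_def)
  have rs: "r \<otimes> s \<in> socle R \<mm>" if "r \<in> carrier R" for r
    using M.submodule_smult[OF socle_is_submodule that s(1)] by simp
  have sub: "submodule (PIdl s) R (regular_module R)"
    using cgenideal_ideal[OF sc] submodule_regular_iff by simp
  have gen: "PIdl s = socle R \<mm>"
  proof (rule ccontr)
    assume ne: "PIdl s \<noteq> socle R \<mm>"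
    have "PIdl s \<subset> socle R \<mm>" using ne rs by (auto simp: cgenideal_def)
    moreover have "{\<zero>} \<subset> PIdl s"
      using cgenideal_self[OF sc] s(2) M.submodule_zero[OF sub] by auto
    ultimately have "eSuc (sublength R (regular_module R) (PIdl s)) \<le> sublength R (regular_module R) (socle R \<mm>)"
      and "eSuc 0 \<le> sublength R (regular_module R) (PIdl s)"
      using M.sublength_strict_mono[OF sub socle_is_submodule]
        M.sublength_strict_mono[OF M.submodule_zero_set sub] M.sublength_zero_set by simp_all
    then have "eSuc (eSuc 0) \<le> sublength R (regular_module R) (socle R \<mm>)"
      by (meson eSuc_ile_mono order_trans)
    then show False unfolding len by (simp add: one_eSuc)
  qed
  define f where "f t = {r \<in> carrier R. r \<otimes> s = t}" for t
  have f: "f (r \<otimes> s) = \<mm> +> r" if r: "r \<in> carrier R" for r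
  proof -
    have "q \<otimes> s = r \<otimes> s \<longleftrightarrow> q \<in> \<mm> +> r" if q: "q \<in> carrier R" for q
    proof -
      have qr: "q \<ominus> r \<in> carrier R" using q r by simp
      have "(q \<ominus> r) \<otimes> s = q \<otimes> s \<ominus> r \<otimes> s"
        using q r sc by (simp add: a_minus_def l_distr l_minus)
      then have "q \<otimes> s = r \<otimes> s \<longleftrightarrow> (q \<ominus> r) \<otimes> s = \<zero>"
        using r_right_minus_eq[of "q \<otimes> s" "r \<otimes> s"] q r sc by simp
      also have "\<dots> \<longleftrightarrow> q \<ominus> r \<in> \<mm>"
      proof
        assume z: "(q \<ominus> r) \<otimes> s = \<zero>"
        show "q \<ominus> r \<in> \<mm>"
        proof (rule ccontr)
          assume "q \<ominus> r \<notin> \<mm>"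
          then have u: "q \<ominus> r \<in> Units R" using qr unit_if_notin_m by blast
          have "s = inv (q \<ominus> r) \<otimes> ((q \<ominus> r) \<otimes> s)"
            using u sc qr by (metis Units_inv_closed Units_l_inv l_one m_assoc)
          then show False using z s(2) u by simp
        qed
      next
        assume "q \<ominus> r \<in> \<mm>"
        then show "(q \<ominus> r) \<otimes> s = \<zero>" using s(1) by (simp add: socle_def)
      qed
      also have "\<dots> \<longleftrightarrow> q \<in> \<mm> +> r"
      proof
        assume "q \<ominus> r \<in> \<mm>"
        moreover have "q = (q \<ominus> r) \<oplus> r" using q r by (simp add: a_minus_def a_assoc l_neg)
        ultimately show "q \<in> \<mm> +> r" unfolding a_r_coset_def' by blast
      next
        assume "q \<in> \<mm> +> r"
        then obtain h where "h \<in> \<mm>" "q = h \<oplus> r" unfolding a_r_coset_def' by blast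
        moreover from this have "q \<ominus> r = h" using r a_subset
          by (simp add: a_minus_def a_assoc r_neg subset_iff)
        ultimately show "q \<ominus> r \<in> \<mm>" by simp
      qed
      finally show ?thesis .
    qed
    moreover have "\<mm> +> r \<subseteq> carrier R" using r a_r_coset_subset_G[OF a_subset] by blast
    ultimately show ?thesis unfolding f_def by blast
  qed
  have el: "\<exists>r\<in>carrier R. t = r \<otimes> s" if "t \<in> socle R \<mm>" for t
    using that unfolding gen[symmetric] by (auto simp: cgenideal_def)
  have Qc: "carrier (R Quot \<mm>) = {\<mm> +> r | r. r \<in> carrier R}"
    unfolding FactRing_def A_RCOSETS_def' by auto
  have bij: "bij_betw f (socle R \<mm>) (carrier (R Quot \<mm>))"
  proof (rule bij_betw_imageI)
    show "inj_on f (socle R \<mm>)"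
    proof (rule inj_onI)
      fix t t' assume t: "t \<in> socle R \<mm>" "t' \<in> socle R \<mm>" "f t = f t'"
      obtain r where "r \<in> carrier R" "t = r \<otimes> s" using el[OF t(1)] by blast
      then have "r \<in> f t'" unfolding t(3)[symmetric] by (simp add: f_def)
      then show "t = t'" using \<open>t = r \<otimes> s\<close> by (simp add: f_def)
    qed
    show "f ` socle R \<mm> = carrier (R Quot \<mm>)"
    proof
      show "f ` socle R \<mm> \<subseteq> carrier (R Quot \<mm>)"
      proof
        fix X assume "X \<in> f ` socle R \<mm>"
        then obtain t where "t \<in> socle R \<mm>" "X = f t" by blast
        with el obtain r where "r \<in> carrier R" "X = f (r \<otimes> s)" by blast
        then show "X \<in> carrier (R Quot \<mm>)" using f[of r] unfolding Qc by blast
      qed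
      show "carrier (R Quot \<mm>) \<subseteq> f ` socle R \<mm>"
      proof
        fix X assume "X \<in> carrier (R Quot \<mm>)"
        then obtain r where r: "r \<in> carrier R" "X = \<mm> +> r" unfolding Qc by blast
        show "X \<in> f ` socle R \<mm>" by (rule image_eqI[OF _ rs[OF r(1)]]) (simp only: f[OF r(1)] r(2))
      qed
    qed
  qed
  have add: "f (t \<oplus> t') = f t \<oplus>\<^bsub>R Quot \<mm>\<^esub> f t'" if t: "t \<in> socle R \<mm>" "t' \<in> socle R \<mm>" for t t'
  proof -
    obtain r r' where r: "r \<in> carrier R" "t = r \<otimes> s" "r' \<in> carrier R" "t' = r' \<otimes> s"
      using el[OF t(1)] el[OF t(2)] by blast
    then have "t \<oplus> t' = (r \<oplus> r') \<otimes> s" using sc by (simp add: l_distr)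
    then show ?thesis using r hom_add by (simp add: f)
  qed
  have smult: "f (a \<otimes> t) = (\<mm> +> a) \<otimes>\<^bsub>R Quot \<mm>\<^esub> f t" if t: "a \<in> carrier R" "t \<in> socle R \<mm>" for a t
  proof -
    obtain r where r: "r \<in> carrier R" "t = r \<otimes> s" using el[OF t(2)] by blast
    then have "a \<otimes> t = (a \<otimes> r) \<otimes> s" using sc that by (simp add: m_assoc)
    then show ?thesis using r that hom_mult by (simp add: f)
  qed
  show ?thesis
    unfolding frobenius_ring_def module_isomorphic_def
  proof (rule bexI[of _ f])
    show "f \<in> iso (add_monoid (regular_module R\<lparr>carrier := socle R \<mm>\<rparr>)) (add_monoid (quotient_module R \<mm>))"
      using bij add bij_betwE[OF bij] by (simp add: iso_def hom_def quotient_module_def Pi_def)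
    show "\<forall>r\<in>carrier R. \<forall>x\<in>carrier (regular_module R\<lparr>carrier := socle R \<mm>\<rparr>).
        f (r \<odot>\<^bsub>regular_module R\<lparr>carrier := socle R \<mm>\<rparr>\<^esub> x) = r \<odot>\<^bsub>quotient_module R \<mm>\<^esub> f x"
      using smult by (simp add: quotient_module_def)
  qed
qed

end

section \<open>Coordinates, supports and the dot product\<close>

context cring
begin

lemma free_module_simps [simp]:
  "carrier (free_module R n) = {1..n} \<rightarrow>\<^sub>E carrier R"
  "\<zero>\<^bsub>free_module R n\<^esub> = (\<lambda>i\<in>{1..n}. \<zero>)"
  "v \<oplus>\<^bsub>free_module R n\<^esub> w = (\<lambda>i\<in>{1..n}. v i \<oplus> w i)"
  "r \<odot>\<^bsub>free_module R n\<^esub> v = (\<lambda>i\<in>{1..n}. r \<otimes> v i)"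
  by (simp_all add: free_module_def)

lemma dot_prod_closed:
  assumes "v \<in> {1..n} \<rightarrow>\<^sub>E carrier R" "w \<in> {1..n} \<rightarrow>\<^sub>E carrier R"
  shows "dot_prod R n v w \<in> carrier R"
  unfolding dot_prod_def using assms by (auto intro!: finsum_closed simp: PiE_iff)

lemma dot_prod_commute:
  assumes "v \<in> {1..n} \<rightarrow>\<^sub>E carrier R" "w \<in> {1..n} \<rightarrow>\<^sub>E carrier R"
  shows "dot_prod R n v w = dot_prod R n w v"
  unfolding dot_prod_def using assms by (auto intro!: finsum_cong' simp: PiE_iff m_comm)

lemma dot_prod_linear_map:
  assumes w: "w \<in> {1..n} \<rightarrow>\<^sub>E carrier R"
  shows "linear_map R (free_module R n) (regular_module R) (\<lambda>v. dot_prod R n v w)"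
proof -
  interpret M: module R "regular_module R" by (rule regular_module_is_module)
  interpret F: module R "free_module R n" by (rule free_module_is_module)
  show ?thesis
  proof unfold_locales
    fix v assume v: "v \<in> carrier (free_module R n)"
    then show "dot_prod R n v w \<in> carrier (regular_module R)" using dot_prod_closed w by simp
    fix v' assume v': "v' \<in> carrier (free_module R n)"
    have "dot_prod R n (v \<oplus>\<^bsub>free_module R n\<^esub> v') w
        = (\<Oplus>i\<in>{1..n}. v i \<otimes> w i \<oplus> v' i \<otimes> w i)"
      unfolding dot_prod_def
      by (rule finsum_cong') (use v v' w in \<open>auto simp: PiE_iff l_distr\<close>)
    also have "\<dots> = dot_prod R n v w \<oplus> dot_prod R n v' w"
      unfolding dot_prod_def by (rule finsum_addf) (use v v' w in \<open>auto simp: PiE_iff\<close>)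
    finally show "dot_prod R n (v \<oplus>\<^bsub>free_module R n\<^esub> v') w
        = dot_prod R n v w \<oplus>\<^bsub>regular_module R\<^esub> dot_prod R n v' w" by simp
  next
    fix r v assume r: "r \<in> carrier R" and v: "v \<in> carrier (free_module R n)"
    have "dot_prod R n (r \<odot>\<^bsub>free_module R n\<^esub> v) w = (\<Oplus>i\<in>{1..n}. r \<otimes> (v i \<otimes> w i))"
      unfolding dot_prod_def
      by (rule finsum_cong') (use r v w in \<open>auto simp: PiE_iff m_assoc\<close>)
    also have "\<dots> = r \<otimes> dot_prod R n v w"
      unfolding dot_prod_def
      by (rule finsum_rdistr[symmetric]) (use r v w in \<open>auto simp: PiE_iff\<close>)
    finally show "dot_prod R n (r \<odot>\<^bsub>free_module R n\<^esub> v) w = r \<odot>\<^bsub>regular_module R\<^esub> dot_prod R n v w" by simp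
  qed
qed

lemma dot_prod_single:
  assumes v: "v \<in> {1..n} \<rightarrow>\<^sub>E carrier R" and i: "i \<in> {1..n}"
  shows "dot_prod R n v (\<lambda>j\<in>{1..n}. if j = i then \<one> else \<zero>) = v i"
proof -
  have "dot_prod R n v (\<lambda>j\<in>{1..n}. if j = i then \<one> else \<zero>)
      = (\<Oplus>j\<in>{1..n}. if j = i then v j else \<zero>)"
    unfolding dot_prod_def by (rule finsum_cong') (use v in \<open>auto simp: PiE_iff\<close>)
  also have "\<dots> = v i"
    using add.finprod_singleton_swap[of i "{1..n}" v] i v by (auto simp: PiE_iff)
  finally show ?thesis .
qed

lemma orthogonal_code_submodule:
  assumes C: "submodule C R (free_module R n)"
  shows "submodule (orthogonal_code R n C) R (free_module R n)"
proof -
  interpret F: module R "free_module R n" by (rule free_module_is_module)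
  have lin: "linear_map R (free_module R n) (regular_module R) (\<lambda>v. dot_prod R n v w)" if "w \<in> C" for w
    using dot_prod_linear_map F.submodule_subset[OF C] that by auto
  show ?thesis
  proof (rule F.submoduleI')
    show "\<zero>\<^bsub>free_module R n\<^esub> \<in> orthogonal_code R n C"
      unfolding orthogonal_code_def using linear_map.zero[OF lin] by simp
    show "v \<oplus>\<^bsub>free_module R n\<^esub> w \<in> orthogonal_code R n C"
      if "v \<in> orthogonal_code R n C" "w \<in> orthogonal_code R n C" for v w
      using that linear_map.add[OF lin, of _ v w] F.a_closed[of v w]
      unfolding orthogonal_code_def by (simp del: free_module_simps)
    show "r \<odot>\<^bsub>free_module R n\<^esub> v \<in> orthogonal_code R n C"
      if "r \<in> carrier R" "v \<in> orthogonal_code R n C" for r v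
      using that linear_map.smult[OF lin, of _ r v] F.smult_closed[of r v]
      unfolding orthogonal_code_def by (simp del: free_module_simps)
  qed (auto simp: orthogonal_code_def)
qed

lemma coordinate_linear_map:
  assumes i: "i \<in> {1..n}"
  shows "linear_map R (free_module R n) (regular_module R) (\<lambda>v. v i)"
proof -
  interpret M: module R "regular_module R" by (rule regular_module_is_module)
  interpret F: module R "free_module R n" by (rule free_module_is_module)
  show ?thesis by unfold_locales (use i in \<open>auto simp: PiE_iff\<close>)
qed

text \<open>The coordinates in \<open>A\<close> are set to zero rather than removed, so that puncturing is an endomorphism of
  \<open>R\<^sup>n\<close>.\<close>

definition puncture :: "nat \<Rightarrow> nat set \<Rightarrow> (nat \<Rightarrow> 'a) \<Rightarrow> nat \<Rightarrow> 'a"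
  where "puncture n A v = (\<lambda>i\<in>{1..n}. if i \<in> A then \<zero> else v i)"

lemma puncture_linear_map:
  "linear_map R (free_module R n) (free_module R n) (puncture n A)"
proof -
  interpret F: module R "free_module R n" by (rule free_module_is_module)
  show ?thesis by unfold_locales (auto simp: PiE_iff puncture_def fun_eq_iff)
qed

text \<open>The subcode supported in \<open>A\<close> is a kernel, so rank-nullity applies to it.\<close>

lemma supported_subcode_eq_kernel:
  assumes "C \<subseteq> {1..n} \<rightarrow>\<^sub>E carrier R" "A \<subseteq> {1..n}"
  shows "supported_subcode R n C A = {v \<in> C. puncture n A v = \<zero>\<^bsub>free_module R n\<^esub>}"
  unfolding supported_subcode_def supp_def puncture_def
  by (intro Collect_cong conj_cong refl) (auto simp: fun_eq_iff)

lemma supported_subcode_submodule: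
  assumes C: "submodule C R (free_module R n)" and A: "A \<subseteq> {1..n}"
  shows "submodule (supported_subcode R n C A) R (free_module R n)"
proof -
  interpret F: module R "free_module R n" by (rule free_module_is_module)
  interpret p: linear_map R "free_module R n" "free_module R n" "puncture n A" by (rule puncture_linear_map)
  show ?thesis
    using p.kernel_submodule[OF C] supported_subcode_eq_kernel[of C n A] A F.submodule_subset[OF C] by simp
qed

lemma supported_subcode_empty:
  assumes C: "submodule C R (free_module R n)"
  shows "supported_subcode R n C {} = {\<zero>\<^bsub>free_module R n\<^esub>}"
proof -
  interpret F: module R "free_module R n" by (rule free_module_is_module)
  have "v = (\<lambda>i\<in>{1..n}. \<zero>)" if "v \<in> supported_subcode R n C {}" for v
    using that F.submodule_subset[OF C]
    by (auto simp: supported_subcode_def supp_def fun_eq_iff PiE_iff extensional_def subset_iff)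
  moreover have "(\<lambda>i\<in>{1..n}. \<zero>) \<in> supported_subcode R n C {}"
    using F.submodule_zero[OF C] by (simp add: supported_subcode_def supp_def)
  ultimately show ?thesis unfolding free_module_simps by blast
qed

lemma supported_subcode_full: "supported_subcode R n C {1..n} = C"
  by (auto simp: supported_subcode_def supp_def)

end

section \<open>Lengths of orthogonal codes\<close>

context local_artinian_ring
begin

lemma ring_length_eq: "module_length R (regular_module R) = enat (ring_length R)"
  using module_length_regular_finite by (cases "module_length R (regular_module R)") (auto simp: ring_length_def)

lemma sublength_coordinate_submodule:
  assumes A: "A \<subseteq> {1..n}"
  shows "sublength R (free_module R n) (supported_subcode R n (carrier (free_module R n)) A)
    = enat (ring_length R * card A)"
proof -
  interpret F: module R "free_module R n" by (rule free_module_is_module)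
  have fin: "finite A" using A finite_subset by blast
  let ?K = "\<lambda>A. supported_subcode R n (carrier (free_module R n)) A"
  from fin A show ?thesis
  proof (induction A rule: finite_induct)
    case empty
    show ?case
      unfolding supported_subcode_empty[OF F.carrier_is_submodule] F.sublength_zero_set
      by (simp add: zero_enat_def)
  next
    case (insert i A)
    have i: "i \<in> {1..n}" and A: "A \<subseteq> {1..n}" using insert by auto
    interpret c: linear_map R "free_module R n" "regular_module R" "\<lambda>v. v i"
      by (rule coordinate_linear_map[OF i])
    have sub: "submodule (?K (insert i A)) R (free_module R n)"
      by (rule supported_subcode_submodule[OF F.carrier_is_submodule insert.prems])
    have ker: "{v \<in> ?K (insert i A). v i = \<zero>\<^bsub>regular_module R\<^esub>} = ?K A"
      using i insert.hyps by (auto simp: supported_subcode_def supp_def)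
    have im: "(\<lambda>v. v i) ` ?K (insert i A) = carrier R"
    proof
      show "(\<lambda>v. v i) ` ?K (insert i A) \<subseteq> carrier R"
        using i by (auto simp: supported_subcode_def PiE_iff)
      show "carrier R \<subseteq> (\<lambda>v. v i) ` ?K (insert i A)"
      proof
        fix x assume "x \<in> carrier R"
        then show "x \<in> (\<lambda>v. v i) ` ?K (insert i A)"
          using i by (intro image_eqI[of _ _ "\<lambda>j\<in>{1..n}. if j = i then x else \<zero>"])
            (auto simp: supported_subcode_def supp_def)
      qed
    qed
    have "sublength R (free_module R n) (?K (insert i A))
        = enat (ring_length R * card A) + enat (ring_length R)"
      using c.sublength_rank_nullity[OF sub] insert.IH[OF A]
      unfolding ker im sublength_regular_carrier ring_length_eq by simp
    then show ?case using insert.hyps by simp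
  qed
qed

lemma sublength_free_module:
  "sublength R (free_module R n) (carrier (free_module R n)) = enat (ring_length R * n)"
  using sublength_coordinate_submodule[of "{1..n}" n] supported_subcode_full by simp

lemma sublength_code:
  assumes C: "submodule C R (free_module R n)"
  shows "sublength R (free_module R n) C = enat (code_length R n C)"
proof -
  interpret F: module R "free_module R n" by (rule free_module_is_module)
  have "sublength R (free_module R n) C \<le> enat (ring_length R * n)"
    using F.sublength_mono[OF C F.carrier_is_submodule F.submodule_subset[OF C]]
    unfolding sublength_free_module .
  then show ?thesis
    unfolding code_length_def by (cases "sublength R (free_module R n) C") auto
qed

text \<open>The form \<open>v \<mapsto> v \<cdot> d\<close> on \<open>B\<^sup>\<bottom>\<close> has kernel \<open>D\<^sup>\<bottom>\<close>, and its values are killed by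
\<open>\<mm>\<close> because \<open>\<mm> d \<subseteq> B\<close>. So the two orthogonal codes differ in length by at most the length of
the socle. This is where the Frobenius property enters.\<close>

lemma orthogonal_step:
  assumes soc: "sublength R (regular_module R) (socle R \<mm>) \<le> 1"
    and B: "submodule B R (free_module R n)" and D: "submodule D R (free_module R n)"
    and BD: "B \<subseteq> D" and d: "d \<in> D"
    and gen: "\<And>x. x \<in> D \<Longrightarrow> \<exists>a\<in>B. \<exists>r\<in>carrier R. x = a \<oplus>\<^bsub>free_module R n\<^esub> r \<odot>\<^bsub>free_module R n\<^esub> d"
    and md: "\<And>r. r \<in> \<mm> \<Longrightarrow> r \<odot>\<^bsub>free_module R n\<^esub> d \<in> B"
  shows "code_length R n (orthogonal_code R n B) \<le> Suc (code_length R n (orthogonal_code R n D))"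
proof -
  let ?F = "free_module R n"
  interpret M: module R "regular_module R" by (rule regular_module_is_module)
  interpret F: module R ?F by (rule free_module_is_module)
  note Dc = F.submodule_subset[OF D]
  have dc: "d \<in> carrier ?F" and dc': "d \<in> {1..n} \<rightarrow>\<^sub>E carrier R" using d Dc by auto
  interpret p: linear_map R ?F "regular_module R" "\<lambda>v. dot_prod R n v d"
    by (rule dot_prod_linear_map[OF dc'])
  have dot2: "dot_prod R n v (a \<oplus>\<^bsub>?F\<^esub> r \<odot>\<^bsub>?F\<^esub> d) = dot_prod R n v a \<oplus> r \<otimes> dot_prod R n v d"
    if v: "v \<in> carrier ?F" and a: "a \<in> carrier ?F" and r: "r \<in> carrier R" for v a r
  proof -
    interpret q: linear_map R ?F "regular_module R" "\<lambda>w. dot_prod R n w v"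
      using dot_prod_linear_map v by simp
    have c: "a \<oplus>\<^bsub>?F\<^esub> r \<odot>\<^bsub>?F\<^esub> d \<in> carrier ?F" "r \<odot>\<^bsub>?F\<^esub> d \<in> carrier ?F"
      using a r dc F.a_closed F.smult_closed by blast+
    have "dot_prod R n v (a \<oplus>\<^bsub>?F\<^esub> r \<odot>\<^bsub>?F\<^esub> d) = dot_prod R n (a \<oplus>\<^bsub>?F\<^esub> r \<odot>\<^bsub>?F\<^esub> d) v"
      by (rule dot_prod_commute) (use v c in simp_all)
    also have "\<dots> = dot_prod R n a v \<oplus> r \<otimes> dot_prod R n d v"
      using q.add[OF a c(2)] q.smult[OF r dc] by simp
    also have "\<dots> = dot_prod R n v a \<oplus> r \<otimes> dot_prod R n v d"
      using dot_prod_commute[of v n a] dot_prod_commute[of v n d] v a dc by simp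
    finally show ?thesis .
  qed
  have sB: "submodule (orthogonal_code R n B) R ?F" and sD: "submodule (orthogonal_code R n D) R ?F"
    using orthogonal_code_submodule B D by auto
  have ker: "{v \<in> orthogonal_code R n B. dot_prod R n v d = \<zero>\<^bsub>regular_module R\<^esub>} = orthogonal_code R n D"
    (is "?L = _")
  proof
    show "orthogonal_code R n D \<subseteq> ?L" using BD d by (auto simp: orthogonal_code_def)
    show "?L \<subseteq> orthogonal_code R n D"
    proof
      fix v assume v: "v \<in> ?L"
      then have vc: "v \<in> carrier ?F" by (simp add: orthogonal_code_def)
      have "dot_prod R n v x = \<zero>" if x: "x \<in> D" for x
      proof -
        obtain a r where a: "a \<in> B" and r: "r \<in> carrier R" and eq: "x = a \<oplus>\<^bsub>?F\<^esub> r \<odot>\<^bsub>?F\<^esub> d"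
          using gen[OF x] by blast
        have ac: "a \<in> carrier ?F" using a BD Dc by blast
        show ?thesis unfolding eq dot2[OF vc ac r]
          using v a r by (simp add: orthogonal_code_def)
      qed
      then show "v \<in> orthogonal_code R n D" using vc by (simp add: orthogonal_code_def)
    qed
  qed
  have im: "(\<lambda>v. dot_prod R n v d) ` orthogonal_code R n B \<subseteq> socle R \<mm>"
  proof
    fix y assume "y \<in> (\<lambda>v. dot_prod R n v d) ` orthogonal_code R n B"
    then obtain v where v: "v \<in> orthogonal_code R n B" "y = dot_prod R n v d" by blast
    have vc: "v \<in> carrier ?F" using v by (simp add: orthogonal_code_def)
    have "x \<otimes> y = \<zero>" if x: "x \<in> \<mm>" for x
    proof -
      have xc: "x \<in> carrier R" using x by auto
      have zB: "\<zero>\<^bsub>?F\<^esub> \<in> B" by (rule F.submodule_zero[OF B])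
      have zc: "\<zero>\<^bsub>?F\<^esub> \<in> carrier ?F" by (rule F.zero_closed)
      have "\<zero>\<^bsub>?F\<^esub> \<oplus>\<^bsub>?F\<^esub> x \<odot>\<^bsub>?F\<^esub> d \<in> B" using F.submodule_add[OF B zB md[OF x]] .
      then have "dot_prod R n v (\<zero>\<^bsub>?F\<^esub> \<oplus>\<^bsub>?F\<^esub> x \<odot>\<^bsub>?F\<^esub> d) = \<zero>" "dot_prod R n v \<zero>\<^bsub>?F\<^esub> = \<zero>"
        using v(1) zB by (auto simp: orthogonal_code_def simp del: free_module_simps)
      then show ?thesis
        using dot2[OF vc zc xc] v(2) xc p.closed[OF vc] by (simp del: free_module_simps)
    qed
    then show "y \<in> socle R \<mm>" using v(2) p.closed[OF vc] by (simp add: socle_def)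
  qed
  have "sublength R (regular_module R) ((\<lambda>v. dot_prod R n v d) ` orthogonal_code R n B) \<le> 1"
    using M.sublength_mono[OF p.image_submodule[OF sB] socle_is_submodule im] soc by (rule order_trans)
  then have "sublength R ?F (orthogonal_code R n B) \<le> sublength R ?F (orthogonal_code R n D) + 1"
    using p.sublength_rank_nullity[OF sB] unfolding ker by (simp add: add_left_mono)
  then show ?thesis by (simp add: sublength_code[OF sB] sublength_code[OF sD] one_enat_def)
qed

text \<open>Climbing from \<open>C\<close> to \<open>D\<close> in single steps, each step adds at least one to the length of the code
and removes at most one from the length of the orthogonal code.\<close>

lemma orthogonal_length_le:
  assumes soc: "sublength R (regular_module R) (socle R \<mm>) \<le> 1"
    and C: "submodule C R (free_module R n)" and D: "submodule D R (free_module R n)"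
    and CD: "C \<subseteq> D"
  shows "code_length R n (orthogonal_code R n C) + code_length R n C
    \<le> code_length R n (orthogonal_code R n D) + code_length R n D"
  using D CD
proof (induction "code_length R n D" arbitrary: D rule: less_induct)
  case (less D)
  interpret F: module R "free_module R n" by (rule free_module_is_module)
  show ?case
  proof (cases "C = D")
    case False
    then have "C \<subset> D" using less.prems by auto
    then obtain B d where B: "submodule B R (free_module R n)" "C \<subseteq> B" "B \<subset> D" "d \<in> D"
      "\<And>x. x \<in> D \<Longrightarrow> \<exists>a\<in>B. \<exists>r\<in>carrier R. x = a \<oplus>\<^bsub>free_module R n\<^esub> r \<odot>\<^bsub>free_module R n\<^esub> d"
      "\<And>r. r \<in> \<mm> \<Longrightarrow> r \<odot>\<^bsub>free_module R n\<^esub> d \<in> B"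
      by (rule exists_submodule_step[OF free_module_is_module C less.prems(1) _ sublength_code[OF less.prems(1)]]) blast
    have "code_length R n (orthogonal_code R n B) \<le> Suc (code_length R n (orthogonal_code R n D))"
      by (rule orthogonal_step[OF soc B(1) less.prems(1) _ B(4)]) (use B in auto)
    moreover have lt: "code_length R n B < code_length R n D"
      using F.sublength_strict_mono[OF B(1) less.prems(1) B(3)]
      by (simp add: sublength_code[OF B(1)] sublength_code[OF less.prems(1)] eSuc_enat)
    moreover have "code_length R n (orthogonal_code R n C) + code_length R n C
        \<le> code_length R n (orthogonal_code R n B) + code_length R n B"
      by (rule less.hyps[OF lt B(1,2)])
    ultimately show ?thesis by linarith
  qed simp
qed

text \<open>The preceding inequality, taken between \<open>0\<close> and \<open>C\<close> and between \<open>C\<close> and \<open>R\<^sup>n\<close>, gives the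
two bounds, because the sum of both lengths is \<open>\<lambda>(R) n\<close> at either end.\<close>

theorem orthogonal_length:
  assumes soc: "sublength R (regular_module R) (socle R \<mm>) \<le> 1"
    and C: "submodule C R (free_module R n)"
  shows "code_length R n (orthogonal_code R n C) + code_length R n C = ring_length R * n"
proof -
  let ?F = "free_module R n"
  interpret F: module R ?F by (rule free_module_is_module)
  have Z: "submodule {\<zero>\<^bsub>?F\<^esub>} R ?F" and T: "submodule (carrier ?F) R ?F"
    by (rule F.submodule_zero_set, rule F.carrier_is_submodule)
  have lZ: "code_length R n {\<zero>\<^bsub>?F\<^esub>} = 0"
    unfolding code_length_def F.sublength_zero_set by (simp add: zero_enat_def)
  have lT: "code_length R n (carrier ?F) = ring_length R * n"
    by (simp only: code_length_def sublength_free_module the_enat.simps)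
  have oZ: "orthogonal_code R n {\<zero>\<^bsub>?F\<^esub>} = carrier ?F"
  proof -
    have "dot_prod R n v \<zero>\<^bsub>?F\<^esub> = \<zero>" if v: "v \<in> carrier ?F" for v
    proof -
      interpret q: linear_map R ?F "regular_module R" "\<lambda>w. dot_prod R n w v"
        using dot_prod_linear_map v by simp
      show ?thesis using q.zero dot_prod_commute[of v n "\<zero>\<^bsub>?F\<^esub>"] v F.zero_closed by simp
    qed
    then show ?thesis unfolding orthogonal_code_def by blast
  qed
  have oT: "orthogonal_code R n (carrier ?F) = {\<zero>\<^bsub>?F\<^esub>}"
  proof
    show "orthogonal_code R n (carrier ?F) \<subseteq> {\<zero>\<^bsub>?F\<^esub>}"
    proof
      fix v assume v: "v \<in> orthogonal_code R n (carrier ?F)"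
      then have vc: "v \<in> {1..n} \<rightarrow>\<^sub>E carrier R" by (simp add: orthogonal_code_def)
      have "v i = \<zero>" if i: "i \<in> {1..n}" for i
      proof -
        have "(\<lambda>j\<in>{1..n}. if j = i then \<one> else \<zero>) \<in> carrier ?F" by auto
        then have "dot_prod R n v (\<lambda>j\<in>{1..n}. if j = i then \<one> else \<zero>) = \<zero>"
          using v unfolding orthogonal_code_def by blast
        then show ?thesis using dot_prod_single[OF vc i] by simp
      qed
      then show "v \<in> {\<zero>\<^bsub>?F\<^esub>}" using vc by (auto simp: fun_eq_iff PiE_iff extensional_def)
    qed
    show "{\<zero>\<^bsub>?F\<^esub>} \<subseteq> orthogonal_code R n (carrier ?F)"
      using F.submodule_zero[OF orthogonal_code_submodule[OF T]] by blast
  qed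
  have "{\<zero>\<^bsub>?F\<^esub>} \<subseteq> C" using F.submodule_zero[OF C] by blast
  from orthogonal_length_le[OF soc Z C this]
  have 1: "ring_length R * n \<le> code_length R n (orthogonal_code R n C) + code_length R n C"
    by (simp only: oZ lZ lT)
  from orthogonal_length_le[OF soc C T F.submodule_subset[OF C]]
  have 2: "code_length R n (orthogonal_code R n C) + code_length R n C \<le> ring_length R * n"
    by (simp only: oT lZ lT)
  from 1 2 show ?thesis by simp
qed

text \<open>The subcode of \<open>C\<^sup>\<bottom>\<close> supported outside \<open>A\<close> is the orthogonal code of \<open>D = C + R\<^sup>A\<close>, where
\<open>R\<^sup>A\<close> consists of the vectors supported in \<open>A\<close>. It is convenient to describe \<open>D\<close> as the set of
vectors that agree with a codeword outside \<open>A\<close>: puncturing at \<open>A\<close> maps \<open>C\<close> and \<open>D\<close> to the same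
code, with kernels \<open>C(A)\<close> and \<open>R\<^sup>A\<close>, which determines the length of \<open>D\<close>.\<close>

theorem orthogonal_supported_length:
  assumes soc: "sublength R (regular_module R) (socle R \<mm>) \<le> 1"
    and C: "submodule C R (free_module R n)" and A: "A \<subseteq> {1..n}"
  shows "code_length R n (supported_subcode R n (orthogonal_code R n C) ({1..n} - A)) + code_length R n C
    = ring_length R * (n - card A) + code_length R n (supported_subcode R n C A)"
proof -
  let ?F = "free_module R n"
  interpret F: module R ?F by (rule free_module_is_module)
  interpret p: linear_map R ?F ?F "puncture n A" by (rule puncture_linear_map)
  note Cc = F.submodule_subset[OF C]
  note T = F.carrier_is_submodule
  have pC: "submodule (puncture n A ` C) R ?F" by (rule p.image_submodule[OF C])
  define D where "D = {v \<in> carrier ?F. puncture n A v \<in> puncture n A ` C}"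
  have D: "submodule D R ?F" unfolding D_def by (rule p.preimage_submodule[OF T pC])
  have CD: "C \<subseteq> D" using Cc by (auto simp: D_def)
  have kerC: "{v \<in> C. puncture n A v = \<zero>\<^bsub>?F\<^esub>} = supported_subcode R n C A"
    using supported_subcode_eq_kernel[of C n A] Cc A by simp
  have kerD: "{v \<in> D. puncture n A v = \<zero>\<^bsub>?F\<^esub>} = supported_subcode R n (carrier ?F) A"
  proof -
    have "\<zero>\<^bsub>?F\<^esub> \<in> puncture n A ` C" by (rule F.submodule_zero[OF pC])
    then have "{v \<in> D. puncture n A v = \<zero>\<^bsub>?F\<^esub>} = {v \<in> carrier ?F. puncture n A v = \<zero>\<^bsub>?F\<^esub>}"
      unfolding D_def by (auto simp del: free_module_simps)
    then show ?thesis using supported_subcode_eq_kernel[of "carrier ?F" n A] A by simp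
  qed
  have imD: "puncture n A ` D = puncture n A ` C" using CD by (auto simp: D_def)
  have lC: "code_length R n C = code_length R n (supported_subcode R n C A) + code_length R n (puncture n A ` C)"
    using p.sublength_rank_nullity[OF C] unfolding kerC
    by (simp add: sublength_code[OF C] sublength_code[OF pC] sublength_code[OF supported_subcode_submodule[OF C A]])
  have lD: "code_length R n D = ring_length R * card A + code_length R n (puncture n A ` C)"
    using p.sublength_rank_nullity[OF D] unfolding kerD imD sublength_coordinate_submodule[OF A]
    by (simp add: sublength_code[OF D] sublength_code[OF pC])
  have dot_puncture: "dot_prod R n v (puncture n A w) = dot_prod R n v w"
    if "v \<in> carrier ?F" "w \<in> carrier ?F" "\<And>i. i \<in> A \<Longrightarrow> v i = \<zero>" for v w
    unfolding dot_prod_def by (rule finsum_cong') (use that A in \<open>auto simp: PiE_iff puncture_def\<close>)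
  have oD: "orthogonal_code R n D = supported_subcode R n (orthogonal_code R n C) ({1..n} - A)"
  proof
    show "orthogonal_code R n D \<subseteq> supported_subcode R n (orthogonal_code R n C) ({1..n} - A)"
    proof
      fix v assume v: "v \<in> orthogonal_code R n D"
      then have vc: "v \<in> {1..n} \<rightarrow>\<^sub>E carrier R" by (simp add: orthogonal_code_def)
      have "v i = \<zero>" if i: "i \<in> A" for i
      proof -
        let ?e = "\<lambda>j\<in>{1..n}. if j = i then \<one> else \<zero>"
        have "puncture n A ?e = \<zero>\<^bsub>?F\<^esub>" using i A by (auto simp: puncture_def fun_eq_iff)
        then have "?e \<in> D" unfolding D_def using F.submodule_zero[OF pC] by auto
        then have "dot_prod R n v ?e = \<zero>" using v unfolding orthogonal_code_def by blast
        then show ?thesis using dot_prod_single[OF vc] i A by auto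
      qed
      then show "v \<in> supported_subcode R n (orthogonal_code R n C) ({1..n} - A)"
        using v CD by (auto simp: supported_subcode_def supp_def orthogonal_code_def)
    qed
    show "supported_subcode R n (orthogonal_code R n C) ({1..n} - A) \<subseteq> orthogonal_code R n D"
    proof
      fix v assume v: "v \<in> supported_subcode R n (orthogonal_code R n C) ({1..n} - A)"
      then have vc: "v \<in> carrier ?F" and vo: "\<And>w. w \<in> C \<Longrightarrow> dot_prod R n v w = \<zero>"
        by (auto simp: supported_subcode_def orthogonal_code_def)
      have z: "v i = \<zero>" if "i \<in> A" for i
      proof -
        have "i \<in> {1..n}" "i \<notin> supp R n v"
          using v that A by (auto simp: supported_subcode_def)
        then show ?thesis by (simp add: supp_def)
      qed
      have "dot_prod R n v w = \<zero>" if w: "w \<in> D" for w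
      proof -
        obtain c where c: "c \<in> C" "puncture n A w = puncture n A c" using w by (auto simp: D_def)
        have wc: "w \<in> carrier ?F" "c \<in> carrier ?F" using w c Cc by (auto simp: D_def)
        have "dot_prod R n v w = dot_prod R n v (puncture n A w)"
          using dot_puncture[OF vc wc(1) z] by simp
        also have "\<dots> = dot_prod R n v c" unfolding c(2) using dot_puncture[OF vc wc(2) z] by simp
        finally show ?thesis using vo[OF c(1)] by simp
      qed
      then show "v \<in> orthogonal_code R n D" using vc by (simp add: orthogonal_code_def)
    qed
  qed
  have "card A \<le> n" using card_mono[OF _ A] by simp
  then have n: "ring_length R * n = ring_length R * (n - card A) + ring_length R * card A"
    by (simp add: distrib_left[symmetric])
  show ?thesis
    using orthogonal_length[OF soc D] lC lD n unfolding oD by linarith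
qed

end

section \<open>The weight enumerator as a sum over supports\<close>

lemma poly_of_int_sum_monom:
  fixes z :: "'r :: comm_ring_1"
  shows "poly (map_poly of_int (\<Sum>A\<in>S. Polynomial.monom (c A) (k A))) z = (\<Sum>A\<in>S. of_int (c A) * z ^ k A)"
proof (induction S rule: infinite_finite_induct)
  case (insert A S)
  have "map_poly of_int (p + q) = (map_poly of_int p + map_poly of_int q :: 'r poly)" for p q :: "int poly"
    by (rule poly_eqI) (simp add: coeff_map_poly)
  then show ?case using insert by (simp add: map_poly_monom poly_monom)
qed simp_all

lemma sum_alternating_binomial:
  fixes x y :: "'r :: comm_ring_1"
  assumes "a \<le> n"
  shows "(\<Sum>i\<in>{a..n}. of_int ((-1) ^ (i - a) * int ((n - a) choose (i - a))) * x ^ (n - i) * y ^ i)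
    = y ^ a * (x - y) ^ (n - a)"
proof -
  have "(x - y) ^ (n - a) = ((- y) + x) ^ (n - a)" by simp
  also have "\<dots> = (\<Sum>j\<le>n - a. of_nat ((n - a) choose j) * (- y) ^ j * x ^ (n - a - j))"
    by (rule binomial_ring)
  finally have "y ^ a * (x - y) ^ (n - a)
      = (\<Sum>j\<le>n - a. y ^ a * (of_nat ((n - a) choose j) * (- y) ^ j * x ^ (n - a - j)))"
    by (simp add: sum_distrib_left)
  also have "\<dots> = (\<Sum>i\<in>{a..n}. of_int ((-1) ^ (i - a) * int ((n - a) choose (i - a))) * x ^ (n - i) * y ^ i)"
  proof (rule sum.reindex_bij_witness[of _ "\<lambda>i. i - a" "\<lambda>j. j + a"])
    fix j assume "j \<in> {..n - a}"
    have "(- y) ^ j = (-1) ^ j * y ^ j" by (rule power_minus)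
    then show "of_int ((-1) ^ (j + a - a) * int ((n - a) choose (j + a - a))) * x ^ (n - (j + a)) * y ^ (j + a)
        = y ^ a * (of_nat ((n - a) choose j) * (- y) ^ j * x ^ (n - a - j))"
      by (simp add: power_add mult_ac add.commute)
  qed (use assms in auto)
  finally show ?thesis by simp
qed

text \<open>Collecting the terms that belong to one subset \<open>A\<close> of size \<open>a\<close>, the alternating binomial sum over
\<open>i\<close> is the expansion of \<open>y^a (x - y)^(n - a)\<close>.\<close>

lemma weight_enumerator_eq_sum_subsets:
  fixes x y z :: "'r :: comm_ring_1"
  shows "weight_enumerator R n C x y z
    = (\<Sum>A\<in>Pow {1..n}. z ^ code_length R n (supported_subcode R n C A) * y ^ card A * (x - y) ^ (n - card A))"
proof -
  let ?S = "Pow {1..n}"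
  let ?l = "\<lambda>A. code_length R n (supported_subcode R n C A)"
  let ?c = "\<lambda>i a. (-1) ^ (i - a) * int ((n - a) choose (i - a))"
  have card_le: "card A \<le> n" if "A \<in> ?S" for A
    using card_mono[of "{1..n}" A] that by auto
  have wp: "weight_poly R n C i = (\<Sum>A\<in>{A\<in>?S. card A \<le> i}. Polynomial.monom (?c i (card A)) (?l A))" for i
  proof -
    have "weight_poly R n C i
        = (\<Sum>a\<in>{0..i}. \<Sum>A\<in>{A \<in> {A\<in>?S. card A \<le> i}. card A = a}. Polynomial.monom (?c i (card A)) (?l A))"
      unfolding weight_poly_def by (intro sum.cong refl) auto
    also have "\<dots> = (\<Sum>A\<in>{A\<in>?S. card A \<le> i}. Polynomial.monom (?c i (card A)) (?l A))"
      by (rule sum.group) auto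
    finally show ?thesis .
  qed
  have "weight_enumerator R n C x y z
      = (\<Sum>i\<in>{0..n}. \<Sum>A\<in>{A\<in>?S. card A \<le> i}. of_int (?c i (card A)) * z ^ ?l A * x ^ (n - i) * y ^ i)"
    unfolding weight_enumerator_def wp poly_of_int_sum_monom by (simp only: sum_distrib_right)
  also have "\<dots> = (\<Sum>A\<in>?S. \<Sum>i\<in>{i\<in>{0..n}. card A \<le> i}. of_int (?c i (card A)) * z ^ ?l A * x ^ (n - i) * y ^ i)"
    by (rule sum.swap_restrict) auto
  also have "\<dots> = (\<Sum>A\<in>?S. z ^ ?l A * y ^ card A * (x - y) ^ (n - card A))"
  proof (rule sum.cong[OF refl])
    fix A assume A: "A \<in> ?S"
    have "(\<Sum>i\<in>{i\<in>{0..n}. card A \<le> i}. of_int (?c i (card A)) * z ^ ?l A * x ^ (n - i) * y ^ i)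
        = (\<Sum>i\<in>{card A..n}. z ^ ?l A * (of_int (?c i (card A)) * x ^ (n - i) * y ^ i))"
      by (rule sum.cong) (auto simp: mult_ac)
    also have "\<dots> = z ^ ?l A * (y ^ card A * (x - y) ^ (n - card A))"
      unfolding sum_distrib_left[symmetric] sum_alternating_binomial[OF card_le[OF A]] ..
    finally show "(\<Sum>i\<in>{i\<in>{0..n}. card A \<le> i}. of_int (?c i (card A)) * z ^ ?l A * x ^ (n - i) * y ^ i)
        = z ^ ?l A * y ^ card A * (x - y) ^ (n - card A)" by (simp add: mult.assoc)
  qed
  finally show ?thesis .
qed

text \<open>The substitution of the MacWilliams identity replaces \<open>x - y\<close> by \<open>z\<^sup>r y\<close> and \<open>y\<close> by \<open>x - y\<close>; it
exchanges the roles of \<open>A\<close> and its complement.\<close>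

lemma weight_enumerator_substituted:
  fixes x y z :: "'r :: comm_ring_1"
  shows "weight_enumerator R n C (x + z ^ r * y - y) (x - y) z
    = (\<Sum>A\<in>Pow {1..n}. z ^ (r * (n - card A) + code_length R n (supported_subcode R n C A))
        * y ^ (n - card A) * (x - y) ^ card A)"
proof -
  have "(x + z ^ r * y - y) - (x - y) = z ^ r * y" by simp
  then show ?thesis
    unfolding weight_enumerator_eq_sum_subsets
    by (intro sum.cong refl) (simp add: power_mult_distrib power_add power_mult mult_ac)
qed

section \<open>The MacWilliams identity and its converse\<close>

lemma var_z_power_times_var_y: "var_z ^ k * var_y = Poly_Mapping.single (0, 1, int k) 1"
proof (induction k)
  case 0
  show ?case by (simp add: var_y_def)
next
  case (Suc k)
  have "var_z ^ Suc k * var_y = var_z * (var_z ^ k * var_y)" by (simp add: mult.assoc)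
  also have "\<dots> = Poly_Mapping.single (0, 1, int (Suc k)) 1"
    unfolding Suc by (simp add: var_z_def mult_single)
  finally show ?case .
qed

lemma var_z_power_times_var_y_inject: "var_z ^ k * var_y = var_z ^ l * var_y \<longleftrightarrow> k = l"
proof
  assume "var_z ^ k * var_y = var_z ^ l * var_y"
  then have "Poly_Mapping.lookup (Poly_Mapping.single (0::nat, 1::nat, int k) (1::int)) (0, 1, int k)
      = Poly_Mapping.lookup (Poly_Mapping.single (0, 1, int l) 1) (0, 1, int k)"
    unfolding var_z_power_times_var_y by simp
  then show "k = l" by (simp add: lookup_single when_def split: if_splits)
qed simp

lemma var_z_power_times_inv_power: "var_z ^ k * (var_z_inv ^ k * w) = w"
proof -
  have "var_z ^ k * var_z_inv ^ k = 1"
    by (simp only: power_mult_distrib[symmetric] var_z_times_var_z_inv power_one)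
  then show ?thesis by (simp only: mult.assoc[symmetric] mult_1_left)
qed

context local_artinian_ring
begin

text \<open>The identity holds summand by summand, the subset \<open>A\<close> on the right corresponding to its complement
on the left.\<close>

theorem macwilliams_identity:
  assumes soc: "sublength R (regular_module R) (socle R \<mm>) \<le> 1"
    and C: "submodule C R (free_module R n)"
  shows "weight_enumerator R n (orthogonal_code R n C) var_x var_y var_z =
    var_z_inv ^ code_length R n C *
      weight_enumerator R n C (var_x + var_z ^ ring_length R * var_y - var_y) (var_x - var_y) var_z"
proof -
  let ?r = "ring_length R" and ?l = "code_length R n C"
  let ?c = "\<lambda>A. code_length R n (supported_subcode R n C A)"
  let ?o = "\<lambda>A. code_length R n (supported_subcode R n (orthogonal_code R n C) A)"
  have "weight_enumerator R n (orthogonal_code R n C) var_x var_y var_z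
      = (\<Sum>A\<in>Pow {1..n}. var_z ^ ?o ({1..n} - A) * var_y ^ (n - card A) * (var_x - var_y) ^ card A)"
    unfolding weight_enumerator_eq_sum_subsets
  proof (rule sum.reindex_bij_witness[of _ "\<lambda>A. {1..n} - A" "\<lambda>A. {1..n} - A"])
    fix A assume A: "A \<in> Pow {1..n}"
    then have fin: "finite A" using finite_subset by auto
    have "card A \<le> n" using card_mono[of "{1..n}" A] A by auto
    then have "card ({1..n} - A) = n - card A" "n - (n - card A) = card A"
      using A fin by (auto simp: card_Diff_subset)
    moreover have "{1..n} - ({1..n} - A) = A" using A by auto
    ultimately show "var_z ^ ?o ({1..n} - ({1..n} - A)) * var_y ^ (n - card ({1..n} - A))
          * (var_x - var_y) ^ card ({1..n} - A)
        = var_z ^ ?o A * var_y ^ card A * (var_x - var_y) ^ (n - card A)" by simp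
  qed auto
  also have "\<dots> = (\<Sum>A\<in>Pow {1..n}. var_z_inv ^ ?l * (var_z ^ (?r * (n - card A) + ?c A)
        * var_y ^ (n - card A) * (var_x - var_y) ^ card A))"
  proof (rule sum.cong[OF refl])
    fix A assume "A \<in> Pow {1..n}"
    then have eq: "?r * (n - card A) + ?c A = ?l + ?o ({1..n} - A)"
      using orthogonal_supported_length[OF soc C, of A] by simp
    have "var_z_inv ^ ?l * var_z ^ (?l + ?o ({1..n} - A)) = var_z ^ ?o ({1..n} - A)"
      using var_z_power_times_inv_power[of ?l "var_z ^ ?o ({1..n} - A)"] by (simp add: power_add mult_ac)
    then show "var_z ^ ?o ({1..n} - A) * var_y ^ (n - card A) * (var_x - var_y) ^ card A
        = var_z_inv ^ ?l * (var_z ^ (?r * (n - card A) + ?c A) * var_y ^ (n - card A) * (var_x - var_y) ^ card A)"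
      unfolding eq by (simp add: mult.assoc[symmetric])
  qed
  finally show ?thesis
    unfolding weight_enumerator_substituted by (simp only: sum_distrib_left)
qed

lemma sum_Pow_1: "(\<Sum>A\<in>Pow {1..1::nat}. g A) = g {} + (g {1} :: 'r :: comm_monoid_add)"
proof -
  have "Pow {1..1::nat} = {{}, {1}}" by (auto simp: subset_singleton_iff)
  then show ?thesis by simp
qed

text \<open>For \<open>n = 1\<close> the identity for a code \<open>C\<close> amounts to \<open>\<lambda>(C) + \<lambda>(C\<^sup>\<bottom>) = \<lambda>(R)\<close>. The code
\<open>C = \<mm>\<close> has length \<open>\<lambda>(R) - 1\<close>, so its orthogonal code, the socle, has length one.\<close>

theorem frobenius_if_macwilliams_identity:
  assumes mw: "\<And>C. submodule C R (free_module R 1) \<Longrightarrow>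
    weight_enumerator R 1 (orthogonal_code R 1 C) var_x var_y var_z =
      var_z_inv ^ code_length R 1 C *
        weight_enumerator R 1 C (var_x + var_z ^ ring_length R * var_y - var_y) (var_x - var_y) var_z"
  shows "frobenius_ring R \<mm>"
proof -
  let ?F = "free_module R 1"
  interpret M: module R "regular_module R" by (rule regular_module_is_module)
  interpret F: module R ?F by (rule free_module_is_module)
  interpret c: linear_map R ?F "regular_module R" "\<lambda>v. v 1" by (rule coordinate_linear_map) simp
  \<comment> \<open>The only coordinate identifies \<open>R\<^sup>1\<close> with \<open>R\<close>.\<close>
  have one: "sublength R ?F C = sublength R (regular_module R) ((\<lambda>v. v 1) ` C)"
    if C: "submodule C R ?F" for C
  proof -
    have "v = (\<lambda>i\<in>{1..1}. \<zero>)" if "v \<in> C" "v 1 = \<zero>" for v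
      using that F.submodule_subset[OF C] by (auto simp: fun_eq_iff PiE_iff extensional_def)
    moreover have "(\<lambda>i\<in>{1..1}. \<zero>) \<in> C"
      using F.submodule_zero[OF C] unfolding free_module_simps .
    moreover have "(\<lambda>i\<in>{1..1::nat}. \<zero>) 1 = \<zero>" by simp
    ultimately have ker: "{v \<in> C. v 1 = \<zero>\<^bsub>regular_module R\<^esub>} = {\<zero>\<^bsub>?F\<^esub>}"
      unfolding free_module_simps regular_module_simps by blast
    show ?thesis using c.sublength_rank_nullity[OF C] unfolding ker F.sublength_zero_set by simp
  qed
  have im: "(\<lambda>v. v 1) ` {v \<in> carrier ?F. v 1 \<in> I} = I" if "I \<subseteq> carrier R" for I
  proof
    show "I \<subseteq> (\<lambda>v. v 1) ` {v \<in> carrier ?F. v 1 \<in> I}"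
    proof
      fix x assume "x \<in> I"
      then show "x \<in> (\<lambda>v. v 1) ` {v \<in> carrier ?F. v 1 \<in> I}"
        using that by (intro image_eqI[of _ _ "\<lambda>i\<in>{1..1}. x"]) auto
    qed
  qed auto
  have dot: "dot_prod R 1 v w = v 1 \<otimes> w 1" if "v \<in> carrier ?F" "w \<in> carrier ?F" for v w
    using that by (simp add: dot_prod_def PiE_iff)
  define C where "C = {v \<in> carrier ?F. v 1 \<in> \<mm>}"
  have sm: "submodule \<mm> R (regular_module R)" using submodule_regular_iff ideal_axioms by simp
  have C: "submodule C R ?F"
    unfolding C_def by (rule c.preimage_submodule[OF F.carrier_is_submodule sm])
  have oC: "orthogonal_code R 1 C = {v \<in> carrier ?F. v 1 \<in> socle R \<mm>}"
  proof -
    have "(\<forall>w\<in>C. dot_prod R 1 v w = \<zero>) \<longleftrightarrow> v 1 \<in> socle R \<mm>" if v: "v \<in> carrier ?F" for v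
    proof -
      have v1: "v 1 \<in> carrier R" using c.closed[OF v] by simp
      have "(\<forall>w\<in>C. dot_prod R 1 v w = \<zero>) \<longleftrightarrow> (\<forall>w\<in>C. w 1 \<otimes> v 1 = \<zero>)"
        using dot[OF v] c.closed v1 by (auto simp: C_def m_comm simp del: free_module_simps)
      also have "\<dots> \<longleftrightarrow> (\<forall>x\<in>(\<lambda>v. v 1) ` C. x \<otimes> v 1 = \<zero>)" by blast
      also have "(\<lambda>v. v 1) ` C = \<mm>" unfolding C_def by (rule im[OF m_subset])
      finally show ?thesis using v1 by (simp add: socle_def)
    qed
    then show ?thesis unfolding orthogonal_code_def by blast
  qed
  have O: "submodule (orthogonal_code R 1 C) R ?F" by (rule orthogonal_code_submodule[OF C])
  have lC: "sublength R (regular_module R) \<mm> = enat (code_length R 1 C)"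
    using one[OF C] im[OF m_subset] sublength_code[OF C] by (simp add: C_def)
  have "socle R \<mm> \<subseteq> carrier R" by (auto simp: socle_def)
  then have lO: "sublength R (regular_module R) (socle R \<mm>) = enat (code_length R 1 (orthogonal_code R 1 C))"
    using one[OF O] im[of "socle R \<mm>"] sublength_code[OF O] oC by simp
  have zero: "code_length R 1 (supported_subcode R 1 D {}) = 0" if "submodule D R ?F" for D
    unfolding supported_subcode_empty[OF that] code_length_def F.sublength_zero_set
    by (simp add: zero_enat_def)
  have full: "supported_subcode R 1 D {1} = D" for D
    using supported_subcode_full[of 1 D] by simp
  let ?r = "ring_length R" and ?l = "code_length R 1 C" and ?o = "code_length R 1 (orthogonal_code R 1 C)"
  have "var_x - var_y + var_z ^ ?o * var_y
      = var_z_inv ^ ?l * (var_z ^ ?r * var_y + var_z ^ ?l * (var_x - var_y))"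
    using mw[OF C] unfolding weight_enumerator_substituted weight_enumerator_eq_sum_subsets sum_Pow_1
    by (simp add: zero[OF C] zero[OF O] full del: One_nat_def)
  then have "var_z ^ ?l * (var_x - var_y + var_z ^ ?o * var_y)
      = var_z ^ ?r * var_y + var_z ^ ?l * (var_x - var_y)"
    using var_z_power_times_inv_power by metis
  then have "var_z ^ (?l + ?o) * var_y = var_z ^ ?r * var_y"
    by (simp add: power_add algebra_simps)
  then have sum: "?l + ?o = ?r" by (simp only: var_z_power_times_var_y_inject)
  have "sublength R (regular_module R) (carrier R) \<le> eSuc (sublength R (regular_module R) \<mm>)"
  proof (rule sublength_step_le[OF regular_module_is_module sm])
    show "submodule (carrier R) R (regular_module R)" using M.carrier_is_submodule by simp
    show "\<exists>a\<in>\<mm>. \<exists>r\<in>carrier R. x = a \<oplus>\<^bsub>regular_module R\<^esub> r \<odot>\<^bsub>regular_module R\<^esub> \<one>" if "x \<in> carrier R" for x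
      using that by (intro bexI[of _ \<zero>] bexI[of _ x]) auto
  qed auto
  then have "?r \<le> Suc ?l" unfolding sublength_regular_carrier ring_length_eq lC by (simp add: eSuc_enat)
  moreover have "Suc ?l \<le> ?r"
  proof -
    have "\<mm> \<subset> carrier R" using m_subset I_notcarr by blast
    moreover have "submodule (carrier R) R (regular_module R)" using M.carrier_is_submodule by simp
    ultimately have "eSuc (sublength R (regular_module R) \<mm>) \<le> sublength R (regular_module R) (carrier R)"
      by (intro M.sublength_strict_mono[OF sm])
    then show ?thesis unfolding sublength_regular_carrier ring_length_eq lC by (simp add: eSuc_enat)
  qed
  ultimately have "?o = 1" using sum by simp
  then show ?thesis using frobenius_if_sublength_socle lO by (simp add: one_enat_def)
qed

end

theorem corollary5p16:
  fixes R :: "('a, 'c) ring_scheme" and \<mm> :: "'a set"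
  assumes "local_artinian_ring R \<mm>"
  shows "frobenius_ring R \<mm> \<longleftrightarrow>
    (\<forall>n\<ge>1. \<forall>C. is_code R n C \<longrightarrow>
      weight_enumerator R n (orthogonal_code R n C) var_x var_y var_z =
        var_z_inv ^ code_length R n C *
          weight_enumerator R n C
            (var_x + var_z ^ ring_length R * var_y - var_y) (var_x - var_y) var_z)"
proof -
  interpret local_artinian_ring R \<mm> by fact
  show ?thesis
  proof
    assume "frobenius_ring R \<mm>"
    from macwilliams_identity[OF frobenius_imp_sublength_socle[OF this]]
    show "\<forall>n\<ge>1. \<forall>C. is_code R n C \<longrightarrow>
      weight_enumerator R n (orthogonal_code R n C) var_x var_y var_z =
        var_z_inv ^ code_length R n C *
          weight_enumerator R n C
            (var_x + var_z ^ ring_length R * var_y - var_y) (var_x - var_y) var_z"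
      by (simp add: is_code_def)
  next
    assume mw: "\<forall>n\<ge>1. \<forall>C. is_code R n C \<longrightarrow>
      weight_enumerator R n (orthogonal_code R n C) var_x var_y var_z =
        var_z_inv ^ code_length R n C *
          weight_enumerator R n C
            (var_x + var_z ^ ring_length R * var_y - var_y) (var_x - var_y) var_z"
    show "frobenius_ring R \<mm>"
      by (rule frobenius_if_macwilliams_identity, rule mw[rule_format]) (simp_all add: is_code_def)
  qed
qed

end
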